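(* Let $F$ be an algebraically closed field of characteristic $0$, $n\ge1$, $V=F^{n+1}$, and let $l>n+1$. Let $\mathbf r=(r_1,\dots,r_l)$ be integers and $k\ge 0$ an integer. Put $k'=r_1+\cdots+r_{n+1}-n-1-k$, $r_i'=r_1+\cdots+r_{n+1}-n-1+r_i-2k$ for $n+2\le i\le l$, and $\mathbf r'=(r_1,\dots,r_{n+1},r'_{n+2},\dots,r'_l)$. Then $$h(\mathbf r;k)=h(\mathbf r';k').$$
   Context: Let $S=S(V)=\bigoplus_kS^k$ be the symmetric algebra (polynomial ring) of $V$, with $S^j=0$ for $j<0$. For points $p_1,\dots,p_l\in V\setminus\{0\}$ and integers $r_i$, $k$, put $h(\mathbf p;\mathbf r;k)=\dim_F\bigl(S^k/\sum_{i}S^{k-r_i}p_i^{r_i}\bigr)$, and let $h(\mathbf r;k)$ be the minimum of $h(\mathbf p;\mathbf r;k)$ over all choices of $\mathbf p$ (i.e. its value for $l$ sufficiently generic points of $\mathbb P(V)=\mathbb P^n$). Conventions: $h(\mathbf r;k)=0$ if $k<0$ or if some $r_i<0$. *)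

theory Defs
  imports "HOL-Computational_Algebra.Polynomial" "HOL-Library.Function_Algebras"
begin

(* Polynomials in the n+1 coordinates of V = F^(n+1) are represented by the
   polynomial functions they induce on F^(n+1) (F infinite, so this is faithful).
   A point of F^(n+1) is a function x :: nat => 'a, only x 0 .. x n matter. *)

definition fscale :: "'a::field \<Rightarrow> ((nat \<Rightarrow> 'a) \<Rightarrow> 'a) \<Rightarrow> ((nat \<Rightarrow> 'a) \<Rightarrow> 'a)" where
  "fscale c f = (\<lambda>x. c * f x)"

abbreviation fspan :: "((nat \<Rightarrow> 'a::field) \<Rightarrow> 'a) set \<Rightarrow> ((nat \<Rightarrow> 'a) \<Rightarrow> 'a) set" where
  "fspan \<equiv> module.span fscale"

abbreviation fdim :: "((nat \<Rightarrow> 'a::field) \<Rightarrow> 'a) set \<Rightarrow> nat" where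
  "fdim \<equiv> vector_space.dim fscale"

definition monom_fun :: "nat \<Rightarrow> (nat \<Rightarrow> nat) \<Rightarrow> (nat \<Rightarrow> 'a::field) \<Rightarrow> 'a" where
  "monom_fun n a = (\<lambda>x. \<Prod>j\<le>n. x j ^ a j)"

(* S^k : homogeneous forms of degree k in n+1 variables; S^k = 0 for k < 0 *)
definition Sdeg :: "nat \<Rightarrow> int \<Rightarrow> ((nat \<Rightarrow> 'a::field) \<Rightarrow> 'a) set" where
  "Sdeg n k = fspan {monom_fun n a | a. int (\<Sum>j\<le>n. a j) = k}"

definition lin_form :: "nat \<Rightarrow> (nat \<Rightarrow> 'a::field) \<Rightarrow> (nat \<Rightarrow> 'a) \<Rightarrow> 'a" where
  "lin_form n p = (\<lambda>x. \<Sum>j\<le>n. p j * x j)"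

(* h(p; r; k) = dim S^k / sum_i S^(k - r_i) p_i^(r_i), points indexed 1..l *)
definition h_pts :: "nat \<Rightarrow> nat \<Rightarrow> (nat \<Rightarrow> nat \<Rightarrow> 'a::field) \<Rightarrow> (nat \<Rightarrow> int) \<Rightarrow> int \<Rightarrow> nat" where
  "h_pts n l p r k =
     (if k < 0 \<or> (\<exists>i\<in>{1..l}. r i < 0) then 0
      else fdim (Sdeg n k :: ((nat \<Rightarrow> 'a) \<Rightarrow> 'a) set)
           - fdim (fspan (\<Union>i\<in>{1..l}.
                {(\<lambda>x. q x * lin_form n (p i) x ^ nat (r i)) | q. q \<in> Sdeg n (k - r i)})))"

definition nonzero_pt :: "nat \<Rightarrow> (nat \<Rightarrow> 'a::zero) \<Rightarrow> bool" where
  "nonzero_pt n v \<longleftrightarrow> (\<exists>j\<le>n. v j \<noteq> 0)"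

definition h_gen :: "'a::field itself \<Rightarrow> nat \<Rightarrow> nat \<Rightarrow> (nat \<Rightarrow> int) \<Rightarrow> int \<Rightarrow> nat" where
  "h_gen _ n l r k =
     (if k < 0 \<or> (\<exists>i\<in>{1..l}. r i < 0) then 0
      else Min {h_pts n l (p :: nat \<Rightarrow> nat \<Rightarrow> 'a) r k | p. \<forall>i\<in>{1..l}. nonzero_pt n (p i)})"

end

theory Submission
  imports Defs "HOL-Library.FuncSet"
begin

text \<open>
  Place the first \<open>n + 1\<close> points at the unit vectors; their powers cut \<open>S\<close> down to the span \<open>A\<close>
  of the monomials in a box, with socle degree \<open>N = k + k'\<close>. For a point \<open>p\<close> with nonzero
  coordinates, multiplication by the form of \<open>p\<close> is the raising operator of an \<open>sl\<^sub>2\<close> action whose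
  lowering operator is \<open>\<Sum>j p\<^sub>j\<^sup>-\<^sup>1 g\<^sub>j\<close>, where \<open>g\<^sub>j\<close> lowers the \<open>j\<close>-th exponent; the Cartan element acts on
  degree \<open>d\<close> by \<open>2 * d - N\<close>, whatever \<open>p\<close> is. Representation theory of \<open>sl\<^sub>2\<close> shows that in degree \<open>k\<close>
  the image of the \<open>r'\<close>-th power of the lowering operator lies in that of the \<open>r\<close>-th power of the
  form. Reflecting the box, suitably rescaled, carries \<open>x\<^sub>j\<close> to \<open>g\<^sub>j\<close>, so it maps the ideal of the
  points \<open>p\<^sup>-\<^sup>1\<close> (the Cremona images) with exponents \<open>r'\<close> in degree \<open>k'\<close> into the ideal of the points
  \<open>p\<close> with exponents \<open>r\<close> in degree \<open>k\<close>. This gives one inequality, and the other one follows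
  because \<open>(r, k) \<mapsto> (r', k')\<close> is an involution.
\<close>

section \<open>Functions on points as a vector space\<close>

interpretation fs: vector_space fscale
  by unfold_locales (auto simp: fscale_def fun_eq_iff algebra_simps)

interpretation fsp: vector_space_pair fscale fscale ..

abbreviation flinear :: "(((nat \<Rightarrow> 'a::field) \<Rightarrow> 'a) \<Rightarrow> ((nat \<Rightarrow> 'a) \<Rightarrow> 'a)) \<Rightarrow> bool" where
  "flinear \<equiv> Vector_Spaces.linear fscale fscale"

lemma flinearI:
  assumes "\<And>u v. f (u + v) = f u + f v" "\<And>c u. f (fscale c u) = fscale c (f u)"
  shows "flinear f"
  using assms fs.vector_space_axioms by (simp add: Vector_Spaces.linear_iff)

lemma fscale_apply [simp]: "fscale c f x = c * f x"
  by (simp add: fscale_def)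

lemma power_fun_apply [simp]: "(f ^ m) x = (f x :: 'a::comm_ring_1) ^ m"
  by (induction m) simp_all

lemma sum_fun_apply: "(\<Sum>i\<in>A. f i) x = (\<Sum>i\<in>A. f i x :: 'a::comm_monoid_add)"
  by (induction A rule: infinite_finite_induct) simp_all

subsection \<open>Linear algebra\<close>

text \<open>Modulo \<open>W'\<close> and \<open>W\<close>, \<open>R\<close> induces a map on
  \<open>V'/W'\<close>: it is well defined because \<open>R\<close> sends \<open>W'\<close> into the
  span of \<open>W\<close>, and its image covers \<open>V/W\<close>. So the quotient dimension
  cannot grow. The finite sets \<open>F'\<close> and \<open>F\<close> keep all dimensions
  finite.\<close>

lemma (in vector_space_pair) codim_le_codim:
  assumes R: "Vector_Spaces.linear s1 s2 R" and "W' \<subseteq> V'" "V' \<subseteq> vs1.span F'" "finite F'"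
    and "W \<subseteq> V" "V \<subseteq> vs2.span F" "finite F"
    and RW: "R ` W' \<subseteq> vs2.span W" and V: "V \<subseteq> vs2.span (R ` V' \<union> W)"
  shows "vs2.dim V - vs2.dim W \<le> vs1.dim V' - vs1.dim W'"
proof -
  interpret R: Vector_Spaces.linear s1 s2 R by (rule R)
  obtain B' where B': "B' \<subseteq> W'" "vs1.independent B'" "W' \<subseteq> vs1.span B'" "card B' = vs1.dim W'"
    using vs1.basis_exists by blast
  obtain B'' where B'': "B' \<subseteq> B''" "B'' \<subseteq> V'" "vs1.independent B''" "V' \<subseteq> vs1.span B''"
    using vs1.maximal_independent_subset_extend[of B' V'] B' assms(2) by blast
  have finB'': "finite B''"
    using vs1.independent_span_bound[OF \<open>finite F'\<close> B''(3)] B''(2) assms(3) by blast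
  have dimV': "card B'' = vs1.dim V'"
    using vs1.basis_card_eq_dim B'' by blast
  obtain B where B: "B \<subseteq> W" "vs2.independent B" "W \<subseteq> vs2.span B" "card B = vs2.dim W"
    using vs2.basis_exists by blast
  have finB: "finite B"
    using vs2.independent_span_bound[OF \<open>finite F\<close> B(2)] B(1) assms(5,6) by blast
  \<comment> \<open>\<open>C\<close> represents a basis of \<open>V'/W'\<close>; its image together
    with a basis of \<open>W\<close> will span \<open>V\<close>.\<close>
  define C where "C = B'' - B'"
  have cardC: "card C = vs1.dim V' - vs1.dim W'"
    unfolding C_def using B'(4) dimV' B''(1) finB''
    by (metis card_Diff_subset finite_subset)
  let ?S = "vs2.span (R ` C \<union> B)"
  have WS: "vs2.span W \<subseteq> ?S"
    using B(3) by (meson Un_upper2 dual_order.trans vs2.span_minimal vs2.span_mono vs2.subspace_span)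
  have "R ` B'' \<subseteq> ?S"
  proof
    fix y assume "y \<in> R ` B''"
    then obtain b where b: "b \<in> B''" "y = R b" by blast
    show "y \<in> ?S"
    proof (cases "b \<in> B'")
      case True
      then show ?thesis using B'(1) RW WS b(2) by blast
    next
      case False
      then show ?thesis using b by (auto simp: C_def intro!: vs2.span_base)
    qed
  qed
  then have "R ` vs1.span B'' \<subseteq> ?S"
    by (metis R.span_image vs2.span_minimal vs2.subspace_span)
  then have "R ` V' \<union> W \<subseteq> ?S"
    using B''(4) WS vs2.span_superset by blast
  then have "V \<subseteq> ?S"
    using V by (meson dual_order.trans vs2.span_minimal vs2.subspace_span)
  moreover have "finite (R ` C \<union> B)" using finB finB'' by (simp add: C_def)
  ultimately have "vs2.dim V \<le> card (R ` C \<union> B)" by (rule vs2.dim_le_card)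
  also have "\<dots> \<le> card (R ` C) + card B" by (rule card_Un_le)
  also have "\<dots> \<le> card C + card B"
    using finB'' by (simp add: C_def card_image_le)
  finally show ?thesis using cardC B(4) by simp
qed

lemma (in vector_space) independent_card_le_dim_span:
  assumes "independent B" "B \<subseteq> V" "V \<subseteq> span F" "finite F"
  shows "card B \<le> dim V"
proof -
  obtain B' where B': "B \<subseteq> B'" "B' \<subseteq> V" "independent B'" "V \<subseteq> span B'"
    using maximal_independent_subset_extend[OF assms(2,1)] by blast
  have "finite B'"
    using independent_span_bound[OF \<open>finite F\<close> B'(3)] B'(2) assms(3) by blast
  then have "card B \<le> card B'" using B'(1) by (rule card_mono)
  also have "card B' = dim V" using B' basis_card_eq_dim by blast
  finally show ?thesis .
qed

section \<open>Independent families of functions and their dependence on a parameter\<close>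

text \<open>Independence is stated for an indexed family and pointwise in \<open>x\<close>, so that
  the members may vary polynomially with a parameter; injectivity of the family is then a
  consequence.\<close>

definition indep_family :: "'i set \<Rightarrow> ('i \<Rightarrow> 'x \<Rightarrow> 'a::field) \<Rightarrow> bool" where
  "indep_family I f \<longleftrightarrow> (\<forall>c. (\<forall>x. (\<Sum>i\<in>I. c i * f i x) = 0) \<longrightarrow> (\<forall>i\<in>I. c i = 0))"

lemma indep_familyD:
  assumes "indep_family I f" "\<And>x. (\<Sum>i\<in>I. c i * f i x) = 0" "i \<in> I"
  shows "c i = 0"
  using assms unfolding indep_family_def by blast

lemma indep_family_imp_inj_on:
  assumes "finite I" "indep_family I f"
  shows "inj_on f I"
proof (rule inj_onI, rule ccontr)
  fix i j assume ij: "i \<in> I" "j \<in> I" "f i = f j" "i \<noteq> j"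
  define c where "c m = (if m = i then 1 else if m = j then -1 else 0 :: 'c)" for m
  have "(\<Sum>m\<in>I. c m * f m x) = 0" for x
  proof -
    have "(\<Sum>m\<in>I. c m * f m x) = (\<Sum>m\<in>{i, j}. c m * f m x)"
      using ij assms(1) by (intro sum.mono_neutral_right) (auto simp: c_def)
    also have "\<dots> = 0" using ij by (simp add: c_def)
    finally show ?thesis .
  qed
  from indep_familyD[OF assms(2) this ij(1)] have "c i = 0" .
  then show False by (simp add: c_def)
qed

lemma indep_family_imp_independent:
  assumes "finite I" "indep_family I f"
  shows "fs.independent (f ` I)"
proof
  assume "fs.dependent (f ` I)"
  then obtain c i where c: "(\<Sum>v\<in>f ` I. fscale (c v) v) = 0" and i: "i \<in> I" "c (f i) \<noteq> 0"
    using assms(1) by (auto simp: fs.dependent_finite)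
  have "(\<Sum>i\<in>I. fscale (c (f i)) (f i)) = 0"
    using c sum.reindex[OF indep_family_imp_inj_on[OF assms], of "\<lambda>v. fscale (c v) v"] by simp
  then have "(\<Sum>i\<in>I. (c \<circ> f) i * f i y) = 0" for y
    by (simp add: fun_eq_iff sum_fun_apply)
  from indep_familyD[OF assms(2) this i(1)] show False using i(2) by simp
qed

lemma independent_imp_indep_family:
  assumes "finite B" "fs.independent B"
  shows "indep_family B (\<lambda>b. b)"
  unfolding indep_family_def
proof (intro allI impI)
  fix c assume 0: "\<forall>x. (\<Sum>i\<in>B. c i * i x) = 0"
  have "(\<Sum>v\<in>B. fscale (c v) v) = 0"
    using 0 by (simp add: fun_eq_iff sum_fun_apply)
  from fs.independentD[OF assms(2,1) order_refl this] show "\<forall>i\<in>B. c i = 0" by blast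
qed

text \<open>One Gaussian elimination step, with a pivot that does not vanish at \<open>t\<^sub>0\<close>.\<close>
lemma finite_not_indep_family_poly:
  fixes g :: "'i \<Rightarrow> 'x \<Rightarrow> 'a::field poly"
  assumes "finite I" "indep_family I (\<lambda>i x. poly (g i x) t0)"
  shows "finite {t. \<not> indep_family I (\<lambda>i x. poly (g i x) t)}"
  using assms
proof (induction I arbitrary: g rule: finite_induct)
  case empty
  then show ?case by (simp add: indep_family_def)
next
  case (insert j I)
  note ind = insert.prems
  have "\<exists>x0. poly (g j x0) t0 \<noteq> 0"
  proof (rule ccontr)
    assume "\<nexists>x0. poly (g j x0) t0 \<noteq> 0"
    then have "(\<Sum>i\<in>insert j I. (if i = j then 1 else 0) * poly (g i x) t0) = 0" for x
      using insert.hyps by (auto intro!: sum.neutral)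
    from indep_familyD[OF ind this, of j] show False by simp
  qed
  then obtain x0 where x0: "poly (g j x0) t0 \<noteq> 0" by blast
  \<comment> \<open>Elimination of member \<open>j\<close> by cross-multiplication with the pivot
    value at \<open>x0\<close>: no division occurs, so the entries remain polynomials in the
    parameter.\<close>
  define h where "h i x = g i x * g j x0 - g i x0 * g j x" for i x
  have "indep_family I (\<lambda>i x. poly (h i x) t0)"
    unfolding indep_family_def
  proof (intro allI impI)
    fix c assume 0: "\<forall>x. (\<Sum>i\<in>I. c i * poly (h i x) t0) = 0"
    \<comment> \<open>A relation among the eliminated members is lifted to one among the original
      members; this coefficient of \<open>j\<close> collects the subtracted terms.\<close>
    define d where "d m = (if m = j then - (\<Sum>i\<in>I. c i * poly (g i x0) t0)
      else c m * poly (g j x0) t0)" for m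
    have "(\<Sum>m\<in>insert j I. d m * poly (g m x) t0) = 0" for x
    proof -
      have "(\<Sum>m\<in>insert j I. d m * poly (g m x) t0)
          = d j * poly (g j x) t0 + (\<Sum>m\<in>I. c m * poly (g j x0) t0 * poly (g m x) t0)"
        using insert.hyps by (auto simp: d_def intro!: sum.cong)
      also have "\<dots> = (\<Sum>i\<in>I. c i * poly (h i x) t0)"
        by (simp add: d_def h_def algebra_simps sum_subtractf sum_distrib_left)
      finally show ?thesis using 0 by simp
    qed
    then have "d i = 0" if "i \<in> I" for i
      using indep_familyD[OF ind, of d i] that by blast
    moreover have "d i = c i * poly (g j x0) t0" if "i \<in> I" for i
      using insert.hyps that by (auto simp: d_def)
    ultimately show "\<forall>i\<in>I. c i = 0" using x0 by simp
  qed
  then have fin: "finite {t. \<not> indep_family I (\<lambda>i x. poly (h i x) t)}"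
    by (rule insert.IH)
  \<comment> \<open>A bad parameter is either bad for the eliminated family or a root of the pivot
    polynomial.\<close>
  have "{t. \<not> indep_family (insert j I) (\<lambda>i x. poly (g i x) t)}
      \<subseteq> {t. \<not> indep_family I (\<lambda>i x. poly (h i x) t)} \<union> {t. poly (g j x0) t = 0}"
  proof (rule ccontr)
    assume "\<not> ?thesis"
    then obtain t where t: "\<not> indep_family (insert j I) (\<lambda>i x. poly (g i x) t)"
      "indep_family I (\<lambda>i x. poly (h i x) t)" "poly (g j x0) t \<noteq> 0" by blast
    obtain c i where c: "\<And>x. (\<Sum>i\<in>insert j I. c i * poly (g i x) t) = 0"
      and i: "i \<in> insert j I" "c i \<noteq> 0"
      using t(1) unfolding indep_family_def by blast
    have rel: "c j * poly (g j x) t = - (\<Sum>i\<in>I. c i * poly (g i x) t)" for x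
      using c[of x] insert.hyps by (simp add: eq_neg_iff_add_eq_0)
    have "(\<Sum>i\<in>I. c i * poly (h i x) t) = 0" for x
    proof -
      have "(\<Sum>i\<in>I. c i * poly (h i x) t) = (\<Sum>i\<in>I. c i * poly (g i x) t) * poly (g j x0) t
          - (\<Sum>i\<in>I. c i * poly (g i x0) t) * poly (g j x) t"
        by (simp add: h_def algebra_simps sum_subtractf sum_distrib_left)
      also have "\<dots> = - (c j * poly (g j x) t) * poly (g j x0) t
          + (c j * poly (g j x0) t) * poly (g j x) t"
        by (simp add: rel)
      finally show ?thesis by simp
    qed
    then have I0: "c i = 0" if "i \<in> I" for i
      using indep_familyD[OF t(2)] that by blast
    then have "c j * poly (g j x0) t = 0" by (simp add: rel)
    then show False using t(3) i I0 by auto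
  qed
  moreover have "finite {t. poly (g j x0) t = 0}"
    using x0 by (intro poly_roots_finite) auto
  ultimately show ?case using fin by (meson finite_Un finite_subset)
qed

text \<open>Dedekind's independence of characters: subtracting \<open>f j y\<close> times the
  relation at \<open>x\<close> from the relation at \<open>y * x\<close> removes member
  \<open>j\<close> and multiplies the coefficient of \<open>i\<close> by
  \<open>f i y - f j y\<close>.\<close>

lemma indep_family_characters:
  fixes f :: "'i \<Rightarrow> 'x::monoid_mult \<Rightarrow> 'a::field"
  assumes "finite I" "inj_on f I" "\<And>i. i \<in> I \<Longrightarrow> f i 1 = 1"
    and "\<And>i x y. i \<in> I \<Longrightarrow> f i (x * y) = f i x * f i y"
  shows "indep_family I f"
  using assms
proof (induction I rule: finite_induct)
  case empty
  then show ?case by (simp add: indep_family_def)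
next
  case (insert j I)
  have IH: "indep_family I f" using insert by auto
  show ?case unfolding indep_family_def
  proof (intro allI impI)
    fix c assume 0: "\<forall>x. (\<Sum>i\<in>insert j I. c i * f i x) = 0"
    have rel: "(\<Sum>i\<in>I. c i * f i x) = - (c j * f j x)" for x
      using 0[rule_format, of x] insert.hyps by (simp add: eq_neg_iff_add_eq_0 add.commute)
    have I0: "c i = 0" if "i \<in> I" for i
    proof -
      have "f i \<noteq> f j" using insert.prems(1) insert.hyps that by (auto simp: inj_on_def)
      then obtain y where y: "f i y \<noteq> f j y" by (auto simp: fun_eq_iff)
      have "(\<Sum>i\<in>I. (c i * (f i y - f j y)) * f i x) = 0" for x
      proof -
        have "(\<Sum>i\<in>I. (c i * (f i y - f j y)) * f i x)
            = (\<Sum>i\<in>I. c i * f i (y * x)) - f j y * (\<Sum>i\<in>I. c i * f i x)"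
          using insert.prems(3)
          by (simp add: algebra_simps sum_subtractf sum_distrib_left)
        also have "\<dots> = 0" unfolding rel using insert.prems(3)[of j] by simp
        finally show ?thesis .
      qed
      from indep_familyD[OF IH this that] show ?thesis using y by simp
    qed
    then have "c j * f j 1 = 0" using rel[of 1] by simp
    then show "\<forall>i\<in>insert j I. c i = 0" using I0 insert.prems(2) by auto
  qed
qed

section \<open>Representation theory of sl2 on a graded space\<close>

text \<open>The module in mind is \<open>V\<close> modulo \<open>X\<close>, handled by
  representatives instead of a quotient type. Degree \<open>d\<close> has weight
  \<open>2 * d - N\<close>, and \<open>V_top\<close> says that the quotient vanishes above degree
  \<open>N\<close>.\<close>

locale graded_sl2 = vector_space scale
  for scale :: "'a::field_char_0 \<Rightarrow> 'b::ab_group_add \<Rightarrow> 'b" (infixr "*s" 75) +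
  fixes V X :: "int \<Rightarrow> 'b set" and e f :: "'b \<Rightarrow> 'b" and N :: int
  assumes linear_e: "Vector_Spaces.linear scale scale e"
    and linear_f: "Vector_Spaces.linear scale scale f"
    and subspace_V: "subspace (V d)" and subspace_X: "subspace (X d)"
    and e_V: "u \<in> V d \<Longrightarrow> e u \<in> V (d + 1)" and f_V: "u \<in> V d \<Longrightarrow> f u \<in> V (d - 1)"
    and f_X: "u \<in> X d \<Longrightarrow> f u \<in> X (d - 1)"
    and commutator: "u \<in> V d \<Longrightarrow> e (f u) - f (e u) = of_int (2 * d - N) *s u"
    and V_top: "d > N \<Longrightarrow> V d \<subseteq> X d"
begin

sublocale e: Vector_Spaces.linear scale scale e by (rule linear_e)
sublocale f: Vector_Spaces.linear scale scale f by (rule linear_f)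

lemma linear_e_funpow: "Vector_Spaces.linear scale scale (e ^^ m)"
proof (induction m)
  case 0
  show ?case using module_hom_ident by (simp add: module_hom_iff_linear id_def)
next
  case (Suc m)
  then show ?case
    using Vector_Spaces.linear_compose[OF Suc linear_e] by (simp only: funpow.simps)
qed

lemma funpow_e_V: "u \<in> V d \<Longrightarrow> (e ^^ m) u \<in> V (d + int m)"
proof (induction m)
  case (Suc m)
  then show ?case using e_V[of "(e ^^ m) u" "d + int m"] by (simp add: algebra_simps)
qed simp

lemma funpow_f_X: "u \<in> X d \<Longrightarrow> (f ^^ m) u \<in> X (d - int m)"
proof (induction m)
  case (Suc m)
  then show ?case using f_X[of "(f ^^ m) u" "d - int m"] by (simp add: algebra_simps)
qed simp

text \<open>Moving \<open>f\<close> past each of the \<open>Suc m\<close> factors \<open>e\<close>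
  costs the weight of the vector met there; the weights \<open>2 * (d + i) - N\<close> for
  \<open>i\<close> from 0 to \<open>m\<close> add up to the stated coefficient.\<close>

lemma f_funpow_e:
  assumes "u \<in> V d"
  shows "f ((e ^^ Suc m) u)
    = (e ^^ Suc m) (f u) - of_int (int (Suc m) * (2 * d - N + int m)) *s (e ^^ m) u"
proof (induction m)
  case 0
  show ?case using commutator[OF assms] by (simp add: algebra_simps)
next
  case (Suc m)
  have "f ((e ^^ Suc (Suc m)) u)
      = e (f ((e ^^ Suc m) u)) - of_int (2 * (d + int (Suc m)) - N) *s (e ^^ Suc m) u"
    using commutator[OF funpow_e_V[OF assms, of "Suc m"]] by (simp add: algebra_simps)
  also have "e (f ((e ^^ Suc m) u))
      = (e ^^ Suc (Suc m)) (f u) - of_int (int (Suc m) * (2 * d - N + int m)) *s (e ^^ Suc m) u"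
    unfolding Suc by (simp add: e.diff e.scale)
  also have "of_int (int (Suc m) * (2 * d - N + int m)) *s (e ^^ Suc m) u
      + of_int (2 * (d + int (Suc m)) - N) *s (e ^^ Suc m) u
      = of_int (int (Suc (Suc m)) * (2 * d - N + int (Suc m))) *s (e ^^ Suc m) u"
    unfolding scale_left_distrib[symmetric] of_int_add[symmetric]
    by (rule arg_cong[where f = "\<lambda>c. of_int c *s (e ^^ Suc m) u"]) (simp add: algebra_simps)
  then have "(e ^^ Suc (Suc m)) (f u)
      - of_int (int (Suc m) * (2 * d - N + int m)) *s (e ^^ Suc m) u
      - of_int (2 * (d + int (Suc m)) - N) *s (e ^^ Suc m) u
      = (e ^^ Suc (Suc m)) (f u)
      - of_int (int (Suc (Suc m)) * (2 * d - N + int (Suc m))) *s (e ^^ Suc m) u"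
    by (simp only: diff_diff_eq)
  finally show ?case .
qed

definition image_mod :: "nat \<Rightarrow> int \<Rightarrow> 'b set" where
  "image_mod r d = {(e ^^ r) u + x | u x. u \<in> V (d - int r) \<and> x \<in> X d}"

lemma image_modI: "u \<in> V (d - int r) \<Longrightarrow> x \<in> X d \<Longrightarrow> (e ^^ r) u + x \<in> image_mod r d"
  unfolding image_mod_def by blast

lemma subspace_image_mod: "subspace (image_mod r d)"
proof -
  interpret er: Vector_Spaces.linear scale scale "e ^^ r" by (rule linear_e_funpow)
  have "image_mod r d = {x + y |x y. x \<in> (e ^^ r) ` V (d - int r) \<and> y \<in> X d}"
    unfolding image_mod_def by blast
  then show ?thesis
    using subspace_sums[OF er.subspace_image[OF subspace_V] subspace_X] by simp
qed

lemma X_subset_image_mod: "X d \<subseteq> image_mod r d"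
proof
  fix x assume "x \<in> X d"
  interpret er: Vector_Spaces.linear scale scale "e ^^ r" by (rule linear_e_funpow)
  show "x \<in> image_mod r d"
    using image_modI[OF subspace_0[OF subspace_V] \<open>x \<in> X d\<close>, of r] by (simp add: er.zero)
qed

text \<open>Commuting \<open>f\<close> past \<open>e ^^ Suc r\<close> consumes at most one factor
  \<open>e\<close>, so \<open>e ^^ r\<close> can still be factored out on the left.\<close>

lemma f_image_mod:
  assumes "y \<in> image_mod (Suc r) (d + 1)"
  shows "f y \<in> image_mod r d"
proof -
  interpret er: Vector_Spaces.linear scale scale "e ^^ r" by (rule linear_e_funpow)
  obtain u x where u: "u \<in> V (d - int r)" and x: "x \<in> X (d + 1)" and y: "y = (e ^^ Suc r) u + x"
    using assms unfolding image_mod_def by auto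
  define c :: 'a where "c = of_int (int (Suc r) * (2 * (d - int r) - N + int r))"
  have "f y = (e ^^ Suc r) (f u) - c *s (e ^^ r) u + f x"
    unfolding y f.add f_funpow_e[OF u] c_def ..
  also have "\<dots> = (e ^^ r) (e (f u) - c *s u) + f x"
    by (simp only: funpow_Suc_right comp_apply er.diff er.scale)
  also have "\<dots> \<in> image_mod r d"
    using e_V[OF f_V[OF u]] u f_X[OF x]
    by (intro image_modI subspace_diff subspace_scale subspace_V) simp_all
  finally show ?thesis .
qed

text \<open>The transpose of: a vector killed by \<open>e\<^sup>r\<close> is killed by \<open>f\<^sup>m\<close>. The downward
  induction on \<open>d\<close> raises \<open>r\<close> with \<open>d\<close> and so lowers \<open>m\<close>, until \<open>m = 0\<close>.\<close>
theorem funpow_f_in_image_mod: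
  assumes "u \<in> V (d + int m)" "m = nat (int r - (2 * d - N))"
  shows "(f ^^ m) u \<in> image_mod r d"
  using assms
proof (induction "nat (N + 1 - d)" arbitrary: d r m u)
  case 0
  then have "u \<in> X (d + int m)" using V_top[of "d + int m"] by auto
  then have "(f ^^ m) u \<in> X d" using funpow_f_X[of u "d + int m" m] by simp
  then show ?case using X_subset_image_mod by blast
next
  case (Suc k)
  have k: "k = nat (N + 1 - (d + 1))" using Suc.hyps(2) by simp
  show ?case
  proof (cases m)
    case (Suc m')
    \<comment> \<open>Passing from \<open>(d, r)\<close> to \<open>(d + 1, r + 1)\<close> lowers
      \<open>r - (2 * d - N)\<close> by one, so the induction hypothesis covers all applications of
      \<open>f\<close> but the last.\<close>
    have "(f ^^ m') u \<in> image_mod (Suc r) (d + 1)"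
      using Suc Suc.prems by (intro Suc.hyps(1)[OF k]) (simp_all add: algebra_simps)
    then show ?thesis using Suc f_image_mod by simp
  next
    case 0
    \<comment> \<open>Here \<open>r \<le> 2 * d - N\<close>, so the exponent of \<open>f\<close> is
      0 in degree \<open>d + 1\<close> as well.\<close>
    have top: "V (d + 1) \<subseteq> image_mod (Suc r) (d + 1)"
      using Suc.hyps(1)[OF k, of _ 0 "Suc r"] Suc.prems(2) 0 by auto
    \<comment> \<open>Factors \<open>e\<close> are extracted from \<open>u\<close> one at a time, by
      solving \<open>f_funpow_e\<close> for \<open>(e ^^ i) y\<close>. The coefficient
      \<open>(i + 1) * (2 * d - N - i)\<close> is positive because
      \<open>i < r \<le> 2 * d - N\<close>.\<close>
    have "i \<le> r \<Longrightarrow> \<exists>y\<in>V (d - int i). \<exists>z\<in>image_mod r d. u = (e ^^ i) y + z" for i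
    proof (induction i)
      case 0
      show ?case
        using Suc.prems(1) \<open>m = 0\<close> subspace_0[OF subspace_image_mod[of r d]]
        by (intro bexI[of _ u] bexI[of _ 0]) simp_all
    next
      case (Suc i)
      then obtain y z where y: "y \<in> V (d - int i)" and z: "z \<in> image_mod r d"
        and u: "u = (e ^^ i) y + z" by auto
      interpret ei: Vector_Spaces.linear scale scale "e ^^ Suc i" by (rule linear_e_funpow)
      define c :: 'a where "c = of_int (int (Suc i) * (2 * (d - int i) - N + int i))"
      have "int (Suc i) * (2 * (d - int i) - N + int i) > 0"
        using Suc.prems \<open>m = nat _\<close> \<open>m = 0\<close> by (intro mult_pos_pos) simp_all
      then have c: "c \<noteq> 0" unfolding c_def by (metis of_int_0_eq_iff less_irrefl)
      have "(e ^^ Suc i) y \<in> V (d + 1)"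
        using funpow_e_V[OF y, of "Suc i"] by simp
      then have fe: "f ((e ^^ Suc i) y) \<in> image_mod r d"
        using top f_image_mod by blast
      have "c *s (e ^^ i) y = (e ^^ Suc i) (f y) - f ((e ^^ Suc i) y)"
        unfolding f_funpow_e[OF y] c_def by simp
      then have "(e ^^ i) y
          = (e ^^ Suc i) (inverse c *s f y) - inverse c *s f ((e ^^ Suc i) y)"
        using c by (metis ei.scale scale_right_diff_distrib scale_scale left_inverse scale_one)
      then have "u = (e ^^ Suc i) (inverse c *s f y)
          + (z - inverse c *s f ((e ^^ Suc i) y))"
        by (simp add: u)
      moreover have "inverse c *s f y \<in> V (d - int (Suc i))"
        using f_V[OF y] by (intro subspace_scale subspace_V) (simp add: algebra_simps)
      moreover have "z - inverse c *s f ((e ^^ Suc i) y) \<in> image_mod r d"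
        using z fe by (intro subspace_diff subspace_scale subspace_image_mod)
      ultimately show ?case by blast
    qed
    from this[of r] obtain y z where y: "y \<in> V (d - int r)" and z: "z \<in> image_mod r d"
      and u: "u = (e ^^ r) y + z" by auto
    have "(e ^^ r) y \<in> image_mod r d"
      using image_modI[OF y subspace_0[OF subspace_X]] by simp
    then show ?thesis using u z 0 subspace_add[OF subspace_image_mod] by simp
  qed
qed

end

subsection \<open>Monomials and forms\<close>

lemma monom_fun_mult: "monom_fun n a * monom_fun n b = monom_fun n (\<lambda>j. a j + b j)"
  by (simp add: monom_fun_def fun_eq_iff power_add prod.distrib)

lemma monom_fun_cong: "(\<And>j. j \<le> n \<Longrightarrow> a j = b j) \<Longrightarrow> monom_fun n a = monom_fun n b"
  by (simp add: monom_fun_def)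

lemma subspace_Sdeg [simp]: "fs.subspace (Sdeg n k)"
  by (simp add: Sdeg_def)

lemma monom_fun_in_Sdeg: "int (\<Sum>j\<le>n. a j) = k \<Longrightarrow> monom_fun n a \<in> Sdeg n k"
  unfolding Sdeg_def by (rule fs.span_base) blast

lemma finite_monomials: "finite {monom_fun n a | a. int (\<Sum>j\<le>n. a j) = k}"
proof (rule finite_subset)
  show "finite (monom_fun n ` ({..n} \<rightarrow>\<^sub>E {..nat k}))"
    by (intro finite_imageI finite_PiE) auto
  show "{monom_fun n a | a. int (\<Sum>j\<le>n. a j) = k} \<subseteq> monom_fun n ` ({..n} \<rightarrow>\<^sub>E {..nat k})"
  proof clarify
    fix a :: "nat \<Rightarrow> nat" assume k: "k = int (\<Sum>j\<le>n. a j)"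
    have "restrict a {..n} \<in> {..n} \<rightarrow>\<^sub>E {..nat (int (\<Sum>j\<le>n. a j))}"
      using member_le_sum[of _ "{..n}" a] by (auto simp del: of_nat_sum)
    moreover have "monom_fun n a = monom_fun n (restrict a {..n})"
      by (rule monom_fun_cong) simp
    ultimately show "monom_fun n a \<in> monom_fun n ` ({..n} \<rightarrow>\<^sub>E {..nat (int (\<Sum>j\<le>n. a j))})"
      by blast
  qed
qed

lemma linear_image_span:
  assumes "flinear T" "fs.subspace W" "\<And>b. b \<in> B \<Longrightarrow> T b \<in> W" "u \<in> fspan B"
  shows "T u \<in> W"
proof -
  interpret T: Vector_Spaces.linear fscale fscale T by (rule assms)
  have "T ` fspan B \<subseteq> W"
    unfolding T.span_image[symmetric] using assms by (intro fs.span_minimal) auto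
  then show ?thesis using assms(4) by blast
qed

lemma linear_image_Sdeg:
  assumes "flinear T" "fs.subspace W" "u \<in> Sdeg n k"
    and "\<And>a. int (\<Sum>j\<le>n. a j) = k \<Longrightarrow> T (monom_fun n a) \<in> W"
  shows "T u \<in> W"
  using assms(3) unfolding Sdeg_def
  by (rule linear_image_span[OF assms(1,2), rotated]) (use assms(4) in blast)

lemma flinear_mult: "flinear ((*) u)"
  by (intro flinearI) (simp_all add: fun_eq_iff algebra_simps)

lemma Sdeg_mult:
  assumes "u \<in> Sdeg n a" "v \<in> Sdeg n b"
  shows "u * v \<in> Sdeg n (a + b)"
proof (rule linear_image_Sdeg[OF flinear_mult _ assms(2)])
  fix \<beta> :: "nat \<Rightarrow> nat" assume \<beta>: "int (\<Sum>j\<le>n. \<beta> j) = b"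
  have "monom_fun n \<beta> * u \<in> Sdeg n (a + b)"
  proof (rule linear_image_Sdeg[OF flinear_mult _ assms(1)])
    fix \<alpha> :: "nat \<Rightarrow> nat" assume "int (\<Sum>j\<le>n. \<alpha> j) = a"
    then show "monom_fun n \<beta> * monom_fun n \<alpha> \<in> Sdeg n (a + b)"
      using \<beta> unfolding monom_fun_mult by (intro monom_fun_in_Sdeg) (simp add: sum.distrib)
  qed simp
  then show "u * monom_fun n \<beta> \<in> Sdeg n (a + b)" by (simp add: mult.commute)
qed simp

lemma one_in_Sdeg: "(1 :: (nat \<Rightarrow> 'a::field) \<Rightarrow> 'a) \<in> Sdeg n 0"
proof -
  have *: "(1 :: (nat \<Rightarrow> 'a) \<Rightarrow> 'a) = monom_fun n (\<lambda>_. 0)" by (simp add: monom_fun_def fun_eq_iff)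
  show ?thesis unfolding * by (rule monom_fun_in_Sdeg) simp
qed

lemma Sdeg_power: "u \<in> Sdeg n a \<Longrightarrow> u ^ m \<in> Sdeg n (int m * a)"
proof (induction m)
  case 0
  show ?case using one_in_Sdeg by (simp only: power_0 of_nat_0 mult_zero_left)
next
  case (Suc m)
  then have "u * u ^ m \<in> Sdeg n (a + int m * a)" by (intro Sdeg_mult)
  moreover have "a + int m * a = int (Suc m) * a" by (simp add: algebra_simps)
  ultimately show ?case by (simp only: power_Suc)
qed

definition var :: "nat \<Rightarrow> (nat \<Rightarrow> 'a) \<Rightarrow> 'a" where
  "var j = (\<lambda>x. x j)"

lemma monom_fun_unit: "j \<le> n \<Longrightarrow> monom_fun n (\<lambda>i. if i = j then m else 0) = var j ^ m"
  by (simp add: monom_fun_def var_def fun_eq_iff if_distrib cong: if_cong)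

lemma monom_fun_split:
  "j \<le> n \<Longrightarrow> m \<le> a j \<Longrightarrow> monom_fun n a = var j ^ m * monom_fun n (a(j := a j - m))"
  unfolding monom_fun_unit[symmetric] monom_fun_mult by (rule monom_fun_cong) auto

lemma var_mult_monom_fun:
  "j \<le> n \<Longrightarrow> var j * monom_fun n a = monom_fun n (a(j := Suc (a j)))"
  by (simp add: monom_fun_split[of j n 1 "a(j := Suc (a j))"])

lemma var_in_Sdeg:
  assumes "j \<le> n"
  shows "(var j :: (nat \<Rightarrow> 'a::field) \<Rightarrow> 'a) \<in> Sdeg n 1"
proof -
  have *: "(var j :: (nat \<Rightarrow> 'a) \<Rightarrow> 'a) = monom_fun n (\<lambda>i. if i = j then 1 else 0)"
    unfolding monom_fun_unit[OF assms] by (rule power_one_right[symmetric])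
  show ?thesis unfolding * using assms by (intro monom_fun_in_Sdeg) simp
qed

lemma lin_form_mult: "lin_form n p * u = (\<Sum>j\<le>n. fscale (p j) (var j * u))"
  by (simp add: fun_eq_iff lin_form_def var_def sum_fun_apply sum_distrib_right mult.assoc)

lemma lin_form_eq: "lin_form n p = (\<Sum>j\<le>n. fscale (p j) (var j))"
  using lin_form_mult[of n p 1] by (simp only: mult_1_right)

lemma lin_form_in_Sdeg: "lin_form n p \<in> Sdeg n 1"
  unfolding lin_form_eq by (intro fs.subspace_sum fs.subspace_scale var_in_Sdeg) simp_all

lemma lin_form_unit:
  assumes "j \<le> n"
  shows "lin_form n (\<lambda>i. if i = j then 1 else 0) = var j"
proof
  fix x :: "nat \<Rightarrow> 'a"
  have "lin_form n (\<lambda>i. if i = j then 1 else 0) x = (\<Sum>i\<le>n. if i = j then x j else 0)"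
    unfolding lin_form_def by (rule sum.cong) auto
  then show "lin_form n (\<lambda>i. if i = j then 1 else 0) x = var j x"
    using assms by (simp add: var_def)
qed

text \<open>In characteristic 0 the exponent at \<open>j\<close> can be read off the value at the
  point with coordinate 2 at \<open>j\<close> and 1 elsewhere.\<close>

lemma monom_fun_eqD:
  assumes "monom_fun n a = (monom_fun n b :: (nat \<Rightarrow> 'a::field_char_0) \<Rightarrow> 'a)" "j \<le> n"
  shows "a j = b j"
proof -
  have ev: "monom_fun n c ((\<lambda>_. 1)(j := 2)) = (of_nat (2 ^ c j) :: 'a)" for c
  proof -
    have "monom_fun n c ((\<lambda>_. 1)(j := 2)) = (\<Prod>i\<le>n. if i = j then 2 ^ c j else (1 :: 'a))"
      unfolding monom_fun_def by (intro prod.cong) auto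
    then show ?thesis using assms(2) by simp
  qed
  have "2 ^ a j = (2 ^ b j :: nat)"
    using fun_cong[OF assms(1), of "(\<lambda>_. 1)(j := 2)"] unfolding ev of_nat_eq_iff .
  then show ?thesis by simp
qed

text \<open>Monomials are characters of the monoid of points under coordinatewise
  multiplication.\<close>

lemma independent_monom_fun:
  "fs.independent (range (monom_fun n) :: ((nat \<Rightarrow> 'a::field_char_0) \<Rightarrow> 'a) set)"
proof
  assume "fs.dependent (range (monom_fun n) :: ((nat \<Rightarrow> 'a) \<Rightarrow> 'a) set)"
  then obtain t c v where t: "finite t" "t \<subseteq> range (monom_fun n :: _ \<Rightarrow> (nat \<Rightarrow> 'a) \<Rightarrow> 'a)"
    and 0: "(\<Sum>v\<in>t. fscale (c v) v) = 0" and v: "v \<in> t" "c v \<noteq> 0"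
    unfolding fs.dependent_explicit by blast
  have "indep_family t (\<lambda>b. b)"
  proof (rule indep_family_characters[OF t(1)])
    fix b assume "b \<in> t"
    then obtain a where b: "b = monom_fun n a" using t(2) by blast
    show "b 1 = 1" by (simp add: b monom_fun_def)
    show "b (x * y) = b x * b y" for x y
      by (simp add: b monom_fun_def power_mult_distrib prod.distrib)
  qed simp
  from indep_family_imp_independent[OF t(1) this] have "fs.independent t" by simp
  from fs.independentD[OF this t(1) order_refl 0 v(1)] show False using v(2) by blast
qed

text \<open>\<open>monom_fun n\<close> forgets exponents beyond \<open>n\<close>, and so must
  \<open>\<phi>\<close>; then \<open>\<phi>\<close> is well defined on monomials, and their
  independence yields a linear extension.\<close>

lemma exists_linear_on_monomials:
  fixes \<phi> :: "(nat \<Rightarrow> nat) \<Rightarrow> ((nat \<Rightarrow> 'a::field_char_0) \<Rightarrow> 'a)"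
  assumes "\<And>a b. (\<And>j. j \<le> n \<Longrightarrow> a j = b j) \<Longrightarrow> \<phi> a = \<phi> b"
  shows "\<exists>T. flinear T \<and> (\<forall>a. T (monom_fun n a) = \<phi> a)"
proof -
  define \<psi> where "\<psi> m = \<phi> (SOME a. monom_fun n a = m)" for m :: "(nat \<Rightarrow> 'a) \<Rightarrow> 'a"
  obtain T where T: "flinear T" "\<forall>m\<in>range (monom_fun n). T m = \<psi> m"
    using fsp.linear_independent_extend[OF independent_monom_fun, of n \<psi>] by metis
  have \<psi>: "\<psi> (monom_fun n a) = \<phi> a" for a
  proof -
    have *: "monom_fun n (SOME b. monom_fun n b = (monom_fun n a :: (nat \<Rightarrow> 'a) \<Rightarrow> 'a))
        = (monom_fun n a :: (nat \<Rightarrow> 'a) \<Rightarrow> 'a)"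
      by (rule someI[where x = a]) (rule refl)
    show ?thesis
      unfolding \<psi>_def by (rule assms) (rule monom_fun_eqD[OF *])
  qed
  have "T (monom_fun n a) = \<phi> a" for a
    using T(2) unfolding \<psi>[symmetric] by (rule bspec) (rule rangeI)
  then show ?thesis using T(1) by (intro exI[of _ T] conjI allI)
qed

subsection \<open>Raising, lowering and reflecting monomials\<close>

text \<open>In the variable \<open>x\<close> with index \<open>j\<close> this is the differential
  operator \<open>(\<rho> j - 1) D - x D^2\<close>, where \<open>D\<close> is the derivative. It is
  the sl2 lowering operator opposite to multiplication by \<open>x\<close> on polynomials truncated
  at \<open>x ^ \<rho> j\<close>. The weight 0 at exponent 0 makes the truncated
  \<open>a j - 1\<close> harmless.\<close>

definition lower_op ::
    "nat \<Rightarrow> (nat \<Rightarrow> nat) \<Rightarrow> nat \<Rightarrow> ((nat \<Rightarrow> 'a::field_char_0) \<Rightarrow> 'a) \<Rightarrow> (nat \<Rightarrow> 'a) \<Rightarrow> 'a" where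
  "lower_op n \<rho> j = (SOME T. flinear T \<and> (\<forall>a. T (monom_fun n a) =
     fscale (of_nat (a j) * (of_nat (\<rho> j) - of_nat (a j))) (monom_fun n (a(j := a j - 1)))))"

text \<open>Poincare duality of the box, with exponents \<open>a j\<close> and
  \<open>\<rho> j - 1 - a j\<close> exchanged. The factorials are those for which multiplication by
  a variable turns into \<open>lower_op\<close>.\<close>

definition reflect_op ::
    "nat \<Rightarrow> (nat \<Rightarrow> nat) \<Rightarrow> ((nat \<Rightarrow> 'a::field_char_0) \<Rightarrow> 'a) \<Rightarrow> (nat \<Rightarrow> 'a) \<Rightarrow> 'a" where
  "reflect_op n \<rho> = (SOME T. flinear T \<and> (\<forall>a. T (monom_fun n a) =
     (if \<forall>j\<le>n. a j < \<rho> j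
      then fscale (\<Prod>j\<le>n. fact (a j) / fact (\<rho> j - 1 - a j)) (monom_fun n (\<lambda>j. \<rho> j - 1 - a j))
      else 0)))"

lemma lower_op:
  assumes "j \<le> n"
  shows linear_lower_op: "flinear (lower_op n \<rho> j :: ((nat \<Rightarrow> 'a::field_char_0) \<Rightarrow> 'a) \<Rightarrow> _)"
    and lower_op_monom_fun: "lower_op n \<rho> j (monom_fun n a :: (nat \<Rightarrow> 'a::field_char_0) \<Rightarrow> 'a) =
      fscale (of_nat (a j) * (of_nat (\<rho> j) - of_nat (a j))) (monom_fun n (a(j := a j - 1)))"
proof -
  let ?\<phi> = "\<lambda>a. fscale (of_nat (a j) * (of_nat (\<rho> j) - of_nat (a j)))
    (monom_fun n (a(j := a j - 1))) :: (nat \<Rightarrow> 'a) \<Rightarrow> 'a"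
  have "?\<phi> a = ?\<phi> b" if "\<And>j. j \<le> n \<Longrightarrow> a j = b j" for a b
    using that assms by (intro arg_cong2[of _ _ _ _ fscale] monom_fun_cong) auto
  from exists_linear_on_monomials[of n ?\<phi>, OF this]
  have *: "\<exists>T. flinear T \<and> (\<forall>a. T (monom_fun n a) = ?\<phi> a)" .
  note * = someI_ex[OF *, folded lower_op_def]
  from * show "flinear (lower_op n \<rho> j :: ((nat \<Rightarrow> 'a) \<Rightarrow> 'a) \<Rightarrow> _)" by (rule conjunct1)
  from * show "lower_op n \<rho> j (monom_fun n a) = ?\<phi> a" by (rule conjunct2[THEN spec])
qed

lemma reflect_op:
  shows linear_reflect_op: "flinear (reflect_op n \<rho> :: ((nat \<Rightarrow> 'a::field_char_0) \<Rightarrow> 'a) \<Rightarrow> _)"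
    and reflect_op_monom_fun: "reflect_op n \<rho> (monom_fun n a :: (nat \<Rightarrow> 'a::field_char_0) \<Rightarrow> 'a) = (if \<forall>j\<le>n. a j < \<rho> j
      then fscale (\<Prod>j\<le>n. fact (a j) / fact (\<rho> j - 1 - a j)) (monom_fun n (\<lambda>j. \<rho> j - 1 - a j))
      else 0)"
proof -
  let ?\<phi> = "\<lambda>a. if \<forall>j\<le>n. a j < \<rho> j
      then fscale (\<Prod>j\<le>n. fact (a j) / fact (\<rho> j - 1 - a j)) (monom_fun n (\<lambda>j. \<rho> j - 1 - a j))
      else 0 :: (nat \<Rightarrow> 'a) \<Rightarrow> 'a"
  have "?\<phi> a = ?\<phi> b" if "\<And>j. j \<le> n \<Longrightarrow> a j = b j" for a b
    using that by (intro if_cong arg_cong2[of _ _ _ _ fscale] prod.cong monom_fun_cong) auto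
  from exists_linear_on_monomials[of n ?\<phi>, OF this]
  have *: "\<exists>T. flinear T \<and> (\<forall>a. T (monom_fun n a) = ?\<phi> a)" .
  note * = someI_ex[OF *, folded reflect_op_def]
  from * show "flinear (reflect_op n \<rho> :: ((nat \<Rightarrow> 'a) \<Rightarrow> 'a) \<Rightarrow> _)" by (rule conjunct1)
  from * show "reflect_op n \<rho> (monom_fun n a) = ?\<phi> a" by (rule conjunct2[THEN spec])
qed

lemma linear_comp: "flinear S \<Longrightarrow> flinear T \<Longrightarrow> flinear (\<lambda>u. T (S u))"
  using Vector_Spaces.linear_compose[of fscale fscale S fscale T] by (simp add: comp_def)

lemma linear_diff: "flinear S \<Longrightarrow> flinear T \<Longrightarrow> flinear (\<lambda>u. S u - T u)"
  by (rule fsp.linear_compose_sub)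

lemma linear_eq_on_Sdeg:
  assumes "flinear S" "flinear T" "u \<in> Sdeg n k"
    and "\<And>a. int (\<Sum>j\<le>n. a j) = k \<Longrightarrow> S (monom_fun n a) = T (monom_fun n a)"
  shows "S u = T u"
proof -
  have "S u - T u \<in> {0}"
    using assms(4) by (intro linear_image_Sdeg[OF linear_diff[OF assms(1,2)] _ assms(3)]) simp_all
  then show ?thesis by simp
qed

lemma reflect_op_var_mult:
  assumes j: "j \<le> n" and u: "u \<in> Sdeg n d"
  shows "reflect_op n \<rho> (var j * u) = lower_op n \<rho> j (reflect_op n \<rho> u)"
proof (rule linear_eq_on_Sdeg[OF linear_comp[OF flinear_mult linear_reflect_op]
    linear_comp[OF linear_reflect_op linear_lower_op[OF j]] u])
  fix a :: "nat \<Rightarrow> nat"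
  interpret L: Vector_Spaces.linear fscale fscale "lower_op n \<rho> j :: (_ \<Rightarrow> 'a) \<Rightarrow> _"
    by (rule linear_lower_op[OF j])
  let ?b = "a(j := Suc (a j))"
  show "reflect_op n \<rho> (var j * monom_fun n a)
      = lower_op n \<rho> j (reflect_op n \<rho> (monom_fun n a :: (nat \<Rightarrow> 'a) \<Rightarrow> 'a))"
  proof (cases "\<forall>i\<le>n. a i < \<rho> i")
    case False
    then have b: "\<not> (\<forall>i\<le>n. ?b i < \<rho> i)" by (auto split: if_splits)
    show ?thesis
      unfolding var_mult_monom_fun[OF j] reflect_op_monom_fun if_not_P[OF False] if_not_P[OF b]
        L.zero ..
  next
    case box: True
    let ?c = "\<lambda>a. \<Prod>i\<le>n. fact (a i) / fact (\<rho> i - 1 - a i) :: 'a"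
    let ?a' = "\<lambda>i. \<rho> i - 1 - a i"
    have rhs: "lower_op n \<rho> j (reflect_op n \<rho> (monom_fun n a :: (nat \<Rightarrow> 'a) \<Rightarrow> 'a))
        = fscale (?c a * (of_nat (?a' j) * (of_nat (\<rho> j) - of_nat (?a' j))))
            (monom_fun n (?a'(j := ?a' j - 1)))"
      unfolding reflect_op_monom_fun if_P[OF box] L.scale lower_op_monom_fun[OF j] fs.scale_scale ..
    show ?thesis
    \<comment> \<open>On the upper face of the box the product leaves the box, while the reflected
      exponent is 0 and is killed by the weight of \<open>lower_op\<close>.\<close>
    proof (cases "Suc (a j) = \<rho> j")
      case True
      then have b: "\<not> (\<forall>i\<le>n. ?b i < \<rho> i)" using j by auto
      have "?a' j = 0" using True by simp
      then show ?thesis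
        unfolding rhs unfolding var_mult_monom_fun[OF j] reflect_op_monom_fun if_not_P[OF b]
        by (simp only: of_nat_0 mult_zero_left mult_zero_right fs.scale_zero_left)
    next
      case False
      then have lt: "Suc (a j) < \<rho> j" using box j by (simp add: Suc_lessI)
      \<comment> \<open>The reflected exponent is \<open>Suc m\<close> before the multiplication and
        \<open>m\<close> after it.\<close>
      then obtain m where m: "\<rho> j = Suc (Suc (a j + m))"
        by (metis add_Suc less_iff_Suc_add)
      have b: "\<forall>i\<le>n. ?b i < \<rho> i" using box lt by simp
      have "?c ?b = fact (Suc (a j)) / fact m * (\<Prod>i\<in>{..n} - {j}. fact (a i) / fact (?a' i))"
        using j m by (subst prod.remove[of _ j]) (auto intro!: prod.cong)
      moreover have "?c a = fact (a j) / fact (Suc m) * (\<Prod>i\<in>{..n} - {j}. fact (a i) / fact (?a' i))"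
        using j m by (subst prod.remove[of _ j]) (auto intro!: prod.cong)
      moreover have "fact (Suc (a j)) / fact m
          = fact (a j) / fact (Suc m) * (of_nat (Suc m) * of_nat (Suc (a j)) :: 'a)"
        by (simp add: field_simps del: of_nat_Suc)
      moreover have "of_nat (\<rho> j) - of_nat (?a' j) = (of_nat (Suc (a j)) :: 'a)" "?a' j = Suc m"
        by (simp_all add: m)
      ultimately have "?c ?b = ?c a * (of_nat (?a' j) * (of_nat (\<rho> j) - of_nat (?a' j)))"
        by (simp only: mult.assoc mult.left_commute mult.commute)
      moreover have "monom_fun n (\<lambda>i. \<rho> i - 1 - ?b i)
          = (monom_fun n (?a'(j := ?a' j - 1)) :: (nat \<Rightarrow> 'a) \<Rightarrow> 'a)"
        by (rule monom_fun_cong) simp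
      ultimately show ?thesis
        unfolding rhs unfolding var_mult_monom_fun[OF j] reflect_op_monom_fun if_P[OF b]
        by (simp only:)
    qed
  qed
qed

lemma reflect_op_in_Sdeg:
  assumes "u \<in> Sdeg n d"
  shows "reflect_op n \<rho> u \<in> Sdeg n ((\<Sum>j\<le>n. int (\<rho> j) - 1) - d)"
proof (rule linear_image_Sdeg[OF linear_reflect_op _ assms])
  fix a :: "nat \<Rightarrow> nat" assume d: "int (\<Sum>j\<le>n. a j) = d"
  show "reflect_op n \<rho> (monom_fun n a) \<in> Sdeg n ((\<Sum>j\<le>n. int (\<rho> j) - 1) - d)"
  proof (cases "\<forall>j\<le>n. a j < \<rho> j")
    case True
    have "int (\<Sum>j\<le>n. \<rho> j - 1 - a j) = (\<Sum>j\<le>n. int (\<rho> j) - 1 - int (a j))"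
      unfolding of_nat_sum using True by (intro sum.cong) (auto simp: of_nat_diff Suc_le_eq)
    also have "\<dots> = (\<Sum>j\<le>n. int (\<rho> j) - 1) - d"
      unfolding d[symmetric] by (simp only: sum_subtractf of_nat_sum)
    finally show ?thesis
      unfolding reflect_op_monom_fun if_P[OF True]
      by (intro fs.subspace_scale subspace_Sdeg monom_fun_in_Sdeg)
  next
    case False
    show ?thesis
      unfolding reflect_op_monom_fun if_not_P[OF False] by (intro fs.subspace_0 subspace_Sdeg)
  qed
qed simp

section \<open>The monomial ideal outside the box and the sl2 action of a point\<close>

definition outside_box :: "nat \<Rightarrow> (nat \<Rightarrow> nat) \<Rightarrow> int \<Rightarrow> ((nat \<Rightarrow> 'a::field) \<Rightarrow> 'a) set" where
  "outside_box n \<rho> d = fspan {monom_fun n a | a. int (\<Sum>j\<le>n. a j) = d \<and> (\<exists>j\<le>n. \<rho> j \<le> a j)}"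

lemma monom_fun_in_outside_box:
  "int (\<Sum>j\<le>n. a j) = d \<Longrightarrow> j \<le> n \<Longrightarrow> \<rho> j \<le> a j \<Longrightarrow> monom_fun n a \<in> outside_box n \<rho> d"
  unfolding outside_box_def by (rule fs.span_base) blast

lemma mult_fscale: "u * fscale c v = fscale c (u * v)"
  by (simp add: fun_eq_iff)

text \<open>Operators in different variables commute. In a single variable with exponent
  \<open>a\<close> the coefficient is \<open>a * (\<rho> - a) - (a + 1) * (\<rho> - a - 1) = 2 * a -
  (\<rho> - 1)\<close>.\<close>

lemma commutator_var_lower_op:
  assumes "i \<le> n" and j: "j \<le> n"
  shows "var i * lower_op n \<rho> j (monom_fun n a :: (nat \<Rightarrow> 'a::field_char_0) \<Rightarrow> 'a)
      - lower_op n \<rho> j (var i * monom_fun n a)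
    = (if i = j then fscale (of_int (2 * int (a j) - (int (\<rho> j) - 1))) (monom_fun n a) else 0)"
proof (cases "i = j")
  case False
  let ?b = "a(j := a j - 1)"
  have b: "?b(i := Suc (?b i)) = (a(i := Suc (a i)))(j := a j - 1)" "(a(i := Suc (a i))) j = a j"
    using False by auto
  have "var i * lower_op n \<rho> j (monom_fun n a :: (nat \<Rightarrow> 'a) \<Rightarrow> 'a)
      = lower_op n \<rho> j (var i * monom_fun n a)"
    unfolding lower_op_monom_fun[OF j] mult_fscale var_mult_monom_fun[OF assms(1)] b ..
  then show ?thesis unfolding if_not_P[OF False] by simp
next
  case True
  have 1: "lower_op n \<rho> j (var j * monom_fun n a :: (nat \<Rightarrow> 'a) \<Rightarrow> 'a)
      = fscale (of_nat (Suc (a j)) * (of_nat (\<rho> j) - of_nat (Suc (a j)))) (monom_fun n a)"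
    unfolding var_mult_monom_fun[OF j] lower_op_monom_fun[OF j] by simp
  have 2: "var j * lower_op n \<rho> j (monom_fun n a :: (nat \<Rightarrow> 'a) \<Rightarrow> 'a)
      = fscale (of_nat (a j) * (of_nat (\<rho> j) - of_nat (a j))) (monom_fun n a)"
  \<comment> \<open>Raising does not undo the truncated lowering of exponent 0, but the coefficient
    vanishes there.\<close>
  proof (cases "a j = 0")
    case True
    then show ?thesis unfolding lower_op_monom_fun[OF j] by (simp add: fun_eq_iff)
  next
    case False
    then have b: "(a(j := a j - 1))(j := Suc ((a(j := a j - 1)) j)) = a" by simp
    show ?thesis
      unfolding lower_op_monom_fun[OF j] mult_fscale var_mult_monom_fun[OF j] b ..
  qed
  have 3: "of_nat (a j) * (of_nat (\<rho> j) - of_nat (a j))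
      - of_nat (Suc (a j)) * (of_nat (\<rho> j) - of_nat (Suc (a j)))
      = (of_int (2 * int (a j) - (int (\<rho> j) - 1)) :: 'a)"
    by (simp add: algebra_simps)
  show ?thesis
    unfolding True 1 2 unfolding fs.scale_left_diff_distrib[symmetric] 3 if_P[OF refl] ..
qed

lemma sum_fun_upd:
  fixes a :: "nat \<Rightarrow> nat"
  assumes "j \<le> n"
  shows "int (\<Sum>i\<le>n. (a(j := b)) i) = int (\<Sum>i\<le>n. a i) - int (a j) + int b"
proof -
  have "(\<Sum>i\<le>n. (a(j := b)) i) = b + (\<Sum>i\<in>{..n} - {j}. a i)"
    using assms by (subst sum.remove[of _ j]) auto
  moreover have "(\<Sum>i\<le>n. a i) = a j + (\<Sum>i\<in>{..n} - {j}. a i)"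
    using assms by (subst sum.remove[of _ j]) auto
  ultimately show ?thesis by simp
qed

definition lower_sum ::
    "nat \<Rightarrow> (nat \<Rightarrow> nat) \<Rightarrow> (nat \<Rightarrow> 'a::field_char_0) \<Rightarrow> ((nat \<Rightarrow> 'a) \<Rightarrow> 'a) \<Rightarrow> (nat \<Rightarrow> 'a) \<Rightarrow> 'a" where
  "lower_sum n \<rho> q u = (\<Sum>j\<le>n. fscale (q j) (lower_op n \<rho> j u))"

lemma linear_lower_sum: "flinear (lower_sum n \<rho> q)"
proof -
  have "flinear (\<lambda>u. \<Sum>j\<le>n. fscale (q j) (lower_op n \<rho> j u))"
    by (intro fsp.linear_compose_sum ballI fsp.linear_compose_scale_right linear_lower_op) simp
  then show ?thesis by (simp only: lower_sum_def[abs_def])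
qed

lemma lower_sum_in_subspace:
  assumes "fs.subspace W" "\<And>j. j \<le> n \<Longrightarrow> lower_op n \<rho> j u \<in> W"
  shows "lower_sum n \<rho> q u \<in> W"
  unfolding lower_sum_def using assms by (intro fs.subspace_sum fs.subspace_scale) auto

lemma lower_op_in_Sdeg:
  assumes j: "j \<le> n" and u: "u \<in> Sdeg n d"
  shows "lower_op n \<rho> j u \<in> Sdeg n (d - 1)"
proof (rule linear_image_Sdeg[OF linear_lower_op[OF j] subspace_Sdeg u])
  fix a :: "nat \<Rightarrow> nat" assume d: "int (\<Sum>j\<le>n. a j) = d"
  show "lower_op n \<rho> j (monom_fun n a) \<in> Sdeg n (d - 1)"
  proof (cases "a j = 0")
    case True
    then show ?thesis
      unfolding lower_op_monom_fun[OF j] by (simp add: fs.subspace_0)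
  next
    case False
    then have "int (\<Sum>i\<le>n. (a(j := a j - 1)) i) = d - 1"
      unfolding sum_fun_upd[OF j] d by simp
    then show ?thesis
      unfolding lower_op_monom_fun[OF j]
      by (intro fs.subspace_scale subspace_Sdeg monom_fun_in_Sdeg)
  qed
qed

lemma subspace_outside_box [simp]: "fs.subspace (outside_box n \<rho> d)"
  by (simp add: outside_box_def)

text \<open>The weight of \<open>lower_op\<close> vanishes at exponent \<open>\<rho> j\<close>, just before re-entering the box.\<close>
lemma lower_op_in_outside_box:
  assumes j: "j \<le> n" and u: "u \<in> outside_box n \<rho> d"
  shows "lower_op n \<rho> j u \<in> outside_box n \<rho> (d - 1)"
proof (rule linear_image_span[OF linear_lower_op[OF j] subspace_outside_box _
    u[unfolded outside_box_def]])
  fix b :: "(nat \<Rightarrow> 'a) \<Rightarrow> 'a"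
  assume "b \<in> {monom_fun n a | a. int (\<Sum>j\<le>n. a j) = d \<and> (\<exists>j\<le>n. \<rho> j \<le> a j)}"
  then obtain a i where b: "b = monom_fun n a" and d: "int (\<Sum>j\<le>n. a j) = d"
    and i: "i \<le> n" "\<rho> i \<le> a i" by blast
  show "lower_op n \<rho> j b \<in> outside_box n \<rho> (d - 1)"
  proof (cases "a j = 0 \<or> a j = \<rho> j")
    case True
    then have "of_nat (a j) * (of_nat (\<rho> j) - of_nat (a j)) = (0 :: 'a)" by auto
    then show ?thesis
      unfolding lower_op_monom_fun[OF j] b
      by (simp only: fs.scale_zero_left fs.subspace_0 subspace_outside_box)
  next
    case False
    then have "int (\<Sum>i\<le>n. (a(j := a j - 1)) i) = d - 1"
      unfolding sum_fun_upd[OF j] d by simp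
    moreover have "\<rho> i \<le> (a(j := a j - 1)) i"
      using i False by auto
    ultimately show ?thesis
      unfolding lower_op_monom_fun[OF j] b using i(1)
      by (intro fs.subspace_scale subspace_outside_box monom_fun_in_outside_box)
  qed
qed

text \<open>The corner of the box has exponents \<open>\<rho> j - 1\<close>, so no monomial of
  larger degree fits inside.\<close>

lemma Sdeg_subset_outside_box:
  assumes "d > (\<Sum>j\<le>n. int (\<rho> j) - 1)"
  shows "Sdeg n d \<subseteq> outside_box n \<rho> d"
proof -
  have "monom_fun n a \<in> outside_box n \<rho> d" if d: "int (\<Sum>j\<le>n. a j) = d" for a
  proof -
    have "\<exists>j\<le>n. \<rho> j \<le> a j"
    proof (rule ccontr)
      assume *: "\<not> (\<exists>j\<le>n. \<rho> j \<le> a j)"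
      have "int (a j) \<le> int (\<rho> j) - 1" if "j \<le> n" for j
      proof -
        have "a j < \<rho> j" using * that not_le by blast
        then show ?thesis by simp
      qed
      then have "(\<Sum>j\<le>n. int (a j)) \<le> (\<Sum>j\<le>n. int (\<rho> j) - 1)"
        by (intro sum_mono) simp
      then show False using assms d by simp
    qed
    then show ?thesis using monom_fun_in_outside_box[OF d] by blast
  qed
  then show ?thesis
    unfolding Sdeg_def by (intro fs.span_minimal subspace_outside_box) blast
qed

text \<open>Only the diagonal terms of the double sum survive; \<open>p j * q j = 1\<close> strips
  them of the coefficients of the point, and their weights add up to twice the degree minus the
  degree of the corner.\<close>

lemma commutator_lin_form_lower_sum:
  assumes pq: "\<And>j. j \<le> n \<Longrightarrow> p j * q j = 1" and u: "u \<in> Sdeg n d"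
  shows "lin_form n p * lower_sum n \<rho> q u - lower_sum n \<rho> q (lin_form n p * u)
    = fscale (of_int (2 * d - (\<Sum>j\<le>n. int (\<rho> j) - 1))) u"
proof (rule linear_eq_on_Sdeg[OF _ _ u])
  show "flinear (\<lambda>u. lin_form n p * lower_sum n \<rho> q u - lower_sum n \<rho> q (lin_form n p * u))"
    by (intro linear_diff linear_comp[OF linear_lower_sum flinear_mult]
        linear_comp[OF flinear_mult linear_lower_sum])
  show "flinear (fscale (of_int (2 * d - (\<Sum>j\<le>n. int (\<rho> j) - 1))) :: ((nat \<Rightarrow> 'a) \<Rightarrow> 'a) \<Rightarrow> _)"
    by (intro flinearI) (simp_all add: fun_eq_iff algebra_simps)
  fix a :: "nat \<Rightarrow> nat" assume d: "int (\<Sum>j\<le>n. a j) = d"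
  let ?m = "monom_fun n a :: (nat \<Rightarrow> 'a) \<Rightarrow> 'a"
  have 1: "lin_form n p * lower_sum n \<rho> q ?m
      = (\<Sum>i\<le>n. \<Sum>j\<le>n. fscale (p i * q j) (var i * lower_op n \<rho> j ?m))"
    unfolding lin_form_mult lower_sum_def
    by (intro sum.cong refl) (simp only: sum_distrib_left mult_fscale fs.scale_sum_right fs.scale_scale)
  have "lower_op n \<rho> j (lin_form n p * ?m)
      = (\<Sum>i\<le>n. fscale (p i) (lower_op n \<rho> j (var i * ?m)))" if "j \<le> n" for j
  proof -
    interpret L: Vector_Spaces.linear fscale fscale "lower_op n \<rho> j :: ((_ \<Rightarrow> 'a) \<Rightarrow> _) \<Rightarrow> _"
      by (rule linear_lower_op[OF that])
    show ?thesis unfolding lin_form_mult L.sum L.scale ..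
  qed
  then have "lower_sum n \<rho> q (lin_form n p * ?m)
      = (\<Sum>j\<le>n. \<Sum>i\<le>n. fscale (p i * q j) (lower_op n \<rho> j (var i * ?m)))"
    unfolding lower_sum_def
    by (intro sum.cong refl) (simp only: atMost_iff fs.scale_sum_right fs.scale_scale mult.commute)
  also have "\<dots> = (\<Sum>i\<le>n. \<Sum>j\<le>n. fscale (p i * q j) (lower_op n \<rho> j (var i * ?m)))"
    by (rule sum.swap)
  finally have "lin_form n p * lower_sum n \<rho> q ?m - lower_sum n \<rho> q (lin_form n p * ?m)
      = (\<Sum>i\<le>n. \<Sum>j\<le>n. fscale (p i * q j)
          (var i * lower_op n \<rho> j ?m - lower_op n \<rho> j (var i * ?m)))"
    unfolding 1 by (simp only: sum_subtractf fs.scale_right_diff_distrib)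
  also have "\<dots> = (\<Sum>i\<le>n. \<Sum>j\<le>n. if i = j
      then fscale (of_int (2 * int (a j) - (int (\<rho> j) - 1))) ?m else 0)"
  proof (intro sum.cong refl)
    fix i j assume "i \<in> {..n}" "j \<in> {..n}"
    then have ij: "i \<le> n" "j \<le> n" by auto
    show "fscale (p i * q j) (var i * lower_op n \<rho> j ?m - lower_op n \<rho> j (var i * ?m))
        = (if i = j then fscale (of_int (2 * int (a j) - (int (\<rho> j) - 1))) ?m else 0)"
      unfolding commutator_var_lower_op[OF ij] using pq[OF ij(2)] by (simp add: fun_eq_iff)
  qed
  also have "\<dots> = (\<Sum>i\<le>n. fscale (of_int (2 * int (a i) - (int (\<rho> i) - 1))) ?m)"
    by (intro sum.cong refl) simp
  also have "\<dots> = fscale (of_int (\<Sum>i\<le>n. 2 * int (a i) - (int (\<rho> i) - 1))) ?m"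
    by (simp only: fs.scale_sum_left of_int_sum)
  also have "(\<Sum>i\<le>n. 2 * int (a i) - (int (\<rho> i) - 1)) = 2 * d - (\<Sum>j\<le>n. int (\<rho> j) - 1)"
    unfolding d[symmetric] by (simp only: sum_subtractf of_nat_sum sum_distrib_left)
  finally show "lin_form n p * lower_sum n \<rho> q ?m - lower_sum n \<rho> q (lin_form n p * ?m)
      = fscale (of_int (2 * d - (\<Sum>j\<le>n. int (\<rho> j) - 1))) ?m" .
qed

lemma graded_sl2_forms:
  assumes "\<And>j. j \<le> n \<Longrightarrow> p j * q j = 1"
  shows "graded_sl2 fscale (Sdeg n) (outside_box n \<rho>) ((*) (lin_form n p)) (lower_sum n \<rho> q)
    (\<Sum>j\<le>n. int (\<rho> j) - 1)"
proof (intro graded_sl2.intro graded_sl2_axioms.intro)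
  show "lin_form n p * u \<in> Sdeg n (d + 1)" if "u \<in> Sdeg n d" for u d
    using Sdeg_mult[OF lin_form_in_Sdeg that] by (simp only: add.commute)
qed (intro fs.vector_space_axioms flinear_mult linear_lower_sum subspace_Sdeg subspace_outside_box
    lower_sum_in_subspace lower_op_in_Sdeg lower_op_in_outside_box Sdeg_subset_outside_box
    commutator_lin_form_lower_sum assms; assumption)+

lemma reflect_op_lin_form_mult:
  assumes "u \<in> Sdeg n d"
  shows "reflect_op n \<rho> (lin_form n q * u) = lower_sum n \<rho> q (reflect_op n \<rho> u)"
proof -
  interpret R: Vector_Spaces.linear fscale fscale "reflect_op n \<rho> :: ((_ \<Rightarrow> 'a) \<Rightarrow> _) \<Rightarrow> _"
    by (rule linear_reflect_op)
  show ?thesis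
    unfolding lin_form_mult lower_sum_def R.sum R.scale
    by (intro sum.cong refl) (simp only: atMost_iff reflect_op_var_mult[OF _ assms])
qed

lemma reflect_op_lin_form_power_mult:
  assumes "u \<in> Sdeg n d"
  shows "reflect_op n \<rho> (lin_form n q ^ m * u) = (lower_sum n \<rho> q ^^ m) (reflect_op n \<rho> u)"
proof (induction m)
  case 0
  show ?case by (simp only: power_0 mult_1_left funpow_0)
next
  case (Suc m)
  have "lin_form n q ^ m * u \<in> Sdeg n (int m * 1 + d)"
    by (intro Sdeg_mult Sdeg_power lin_form_in_Sdeg assms)
  from reflect_op_lin_form_mult[OF this] show ?case
    by (simp only: power_Suc mult.assoc funpow.simps comp_apply Suc.IH)
qed

lemma reflect_op_var_power_mult:
  assumes j: "j \<le> n" and u: "u \<in> Sdeg n d"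
  shows "reflect_op n \<rho> (var j ^ \<rho> j * u) = 0"
proof -
  have "reflect_op n \<rho> (var j ^ \<rho> j * u) \<in> {0}"
  proof (rule linear_image_Sdeg[OF linear_comp[OF flinear_mult linear_reflect_op] _ u])
    fix a :: "nat \<Rightarrow> nat"
    have 1: "var j ^ \<rho> j * monom_fun n a = (monom_fun n (a(j := a j + \<rho> j)) :: (nat \<Rightarrow> 'a) \<Rightarrow> 'a)"
      unfolding monom_fun_split[OF j, of "\<rho> j" "a(j := a j + \<rho> j)", simplified] ..
    have "\<not> (\<forall>i\<le>n. (a(j := a j + \<rho> j)) i < \<rho> i)" using j by auto
    then show "reflect_op n \<rho> (var j ^ \<rho> j * (monom_fun n a :: (nat \<Rightarrow> 'a) \<Rightarrow> 'a)) \<in> {0}"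
      unfolding 1 reflect_op_monom_fun by (simp only: if_False singleton_iff)
  qed simp
  then show ?thesis by simp
qed

subsection \<open>Ideals of powers of linear forms\<close>

definition power_ideal ::
    "nat \<Rightarrow> nat \<Rightarrow> (nat \<Rightarrow> nat \<Rightarrow> 'a::field) \<Rightarrow> (nat \<Rightarrow> int) \<Rightarrow> int \<Rightarrow> ((nat \<Rightarrow> 'a) \<Rightarrow> 'a) set" where
  "power_ideal n l p r k =
    fspan {lin_form n (p i) ^ nat (r i) * u | i u. i \<in> {1..l} \<and> u \<in> Sdeg n (k - r i)}"

lemma subspace_power_ideal [simp]: "fs.subspace (power_ideal n l p r k)"
  by (simp add: power_ideal_def)

lemma power_idealI:
  "i \<in> {1..l} \<Longrightarrow> u \<in> Sdeg n (k - r i) \<Longrightarrow> lin_form n (p i) ^ nat (r i) * u \<in> power_ideal n l p r k"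
  unfolding power_ideal_def by (rule fs.span_base) blast

lemma h_pts_eq:
  fixes p :: "nat \<Rightarrow> nat \<Rightarrow> 'a::field"
  assumes "k \<ge> 0" "\<forall>i\<in>{1..l}. r i \<ge> 0"
  shows "h_pts n l p r k = fdim (Sdeg n k :: ((nat \<Rightarrow> 'a) \<Rightarrow> 'a) set) - fdim (power_ideal n l p r k)"
proof -
  have "{lin_form n (p i) ^ nat (r i) * u | i u. i \<in> {1..l} \<and> u \<in> Sdeg n (k - r i)}
      = (\<Union>i\<in>{1..l}. {(\<lambda>x. q x * lin_form n (p i) x ^ nat (r i)) | q. q \<in> Sdeg n (k - r i)})"
    by (auto simp: times_fun_def mult.commute) blast+
  then show ?thesis
    using assms unfolding h_pts_def power_ideal_def by (auto simp: not_less)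
qed

lemma power_ideal_subset_Sdeg:
  fixes p :: "nat \<Rightarrow> nat \<Rightarrow> 'a::field"
  assumes "\<forall>i\<in>{1..l}. r i \<ge> 0"
  shows "power_ideal n l p r k \<subseteq> Sdeg n k"
  unfolding power_ideal_def
proof (rule fs.span_minimal)
  show "{lin_form n (p i) ^ nat (r i) * u | i u. i \<in> {1..l} \<and> u \<in> Sdeg n (k - r i)} \<subseteq> Sdeg n k"
  proof clarify
    fix i and u :: "(nat \<Rightarrow> 'a) \<Rightarrow> 'a"
    assume i: "i \<in> {1..l}" and u: "u \<in> Sdeg n (k - r i)"
    have "int (nat (r i)) * 1 + (k - r i) = k" using assms i by simp
    then show "lin_form n (p i) ^ nat (r i) * u \<in> Sdeg n k"
      using Sdeg_mult[OF Sdeg_power[OF lin_form_in_Sdeg] u] by metis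
  qed
qed simp

text \<open>Points are indexed from 1 and coordinates from 0, so point \<open>Suc j\<close> is the \<open>j\<close>-th unit vector.\<close>
definition special_config :: "nat \<Rightarrow> nat \<Rightarrow> (nat \<Rightarrow> nat \<Rightarrow> 'a::field) \<Rightarrow> bool" where
  "special_config n l p \<longleftrightarrow> n + 1 < l \<and> (\<forall>j\<le>n. p (Suc j) = (\<lambda>i. if i = j then 1 else 0)) \<and>
    (\<forall>i\<in>{n+2..l}. \<forall>j\<le>n. p i j \<noteq> 0)"

lemma special_config_lin_form:
  "special_config n l p \<Longrightarrow> j \<le> n \<Longrightarrow> lin_form n (p (Suc j)) = var j"
  by (simp add: special_config_def lin_form_unit)

section \<open>Special configurations and the two Hilbert functions\<close>

context
  fixes n l :: nat and r :: "nat \<Rightarrow> int" and k :: int and p :: "nat \<Rightarrow> nat \<Rightarrow> 'a::field_char_0"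
    and \<rho> :: "nat \<Rightarrow> nat" and N :: int
  assumes special: "special_config n l p" and r: "\<forall>i\<in>{1..l}. r i \<ge> 0"
  defines "\<rho> \<equiv> \<lambda>j. nat (r (Suc j))" and "N \<equiv> \<Sum>j\<le>n. int (\<rho> j) - 1"
begin

text \<open>A monomial outside the box is divisible by some \<open>var j ^ \<rho> j\<close>, which
  is the prescribed power of the form of point \<open>Suc j\<close>.\<close>

lemma outside_box_subset_power_ideal: "outside_box n \<rho> k \<subseteq> power_ideal n l p r k"
  unfolding outside_box_def
proof (rule fs.span_minimal)
  show "{monom_fun n a | a. int (\<Sum>j\<le>n. a j) = k \<and> (\<exists>j\<le>n. \<rho> j \<le> a j)} \<subseteq> power_ideal n l p r k"
  proof clarify
    fix a j assume k: "k = int (\<Sum>j\<le>n. a j)" and j: "j \<le> n" "\<rho> j \<le> a j"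
    have i: "Suc j \<in> {1..l}" using special j(1) by (simp add: special_config_def)
    have "int (\<Sum>i\<le>n. (a(j := a j - \<rho> j)) i) = k - r (Suc j)"
      unfolding sum_fun_upd[OF j(1)] k using j(2) r i by (auto simp: \<rho>_def of_nat_diff)
    from power_idealI[where r = r and p = p, OF i monom_fun_in_Sdeg[OF this]]
    show "monom_fun n a \<in> power_ideal n l p r (int (\<Sum>j\<le>n. a j))"
      unfolding special_config_lin_form[OF special j(1)] monom_fun_split[where a = a and m = "\<rho> j", OF j] k \<rho>_def .
  qed
qed simp

text \<open>This is \<open>funpow_f_in_image_mod\<close> in degree \<open>k\<close> for the action
  of point \<open>i\<close>: both the multiples of the power of its form and the monomials outside
  the box lie in the ideal. The exponent \<open>m\<close> is the transformed exponent of point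
  \<open>i\<close>, cut off at 0.\<close>

lemma funpow_lower_sum_in_power_ideal:
  assumes i: "i \<in> {n+2..l}" and m: "m = nat (N + r i - 2 * k)" and u: "u \<in> Sdeg n (k + int m)"
  shows "(lower_sum n \<rho> (\<lambda>j. inverse (p i j)) ^^ m) u \<in> power_ideal n l p r k"
proof -
  interpret graded_sl2 fscale "Sdeg n" "outside_box n \<rho>" "(*) (lin_form n (p i))"
    "lower_sum n \<rho> (\<lambda>j. inverse (p i j))" N
    unfolding N_def using special i by (intro graded_sl2_forms) (auto simp: special_config_def)
  have i': "i \<in> {1..l}" using i by auto
  then have "int (nat (r i)) = r i" using r by simp
  then obtain v x where v: "v \<in> Sdeg n (k - r i)" and x: "x \<in> outside_box n \<rho> k"
    and *: "(lower_sum n \<rho> (\<lambda>j. inverse (p i j)) ^^ m) u = ((*) (lin_form n (p i)) ^^ nat (r i)) v + x"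
    using funpow_f_in_image_mod[where r = "nat (r i)", OF u] m unfolding image_mod_def
    by (auto simp: algebra_simps)
  have "((*) w ^^ d) v = w ^ d * v" for d and w :: "(nat \<Rightarrow> 'a) \<Rightarrow> 'a"
    by (induction d) (simp_all only: funpow_0 funpow.simps comp_apply power_0 power_Suc
        mult_1_left mult.assoc id_apply)
  then show ?thesis
    unfolding * using power_idealI[where r = r and k = k and p = p, OF i' v] x outside_box_subset_power_ideal
    by (metis fs.subspace_add subspace_power_ideal subsetD)
qed

text \<open>These are the cases in which \<open>k'\<close> or a transformed exponent is negative, so
  that the other side is 0 by convention. Either degree \<open>k\<close> lies beyond the box, or the
  preceding lemma with \<open>m = 0\<close> puts all of degree \<open>k\<close> into the
  ideal.\<close>

lemma h_pts_special_eq_0: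
  assumes k: "k \<ge> 0" and "N < k \<or> (\<exists>i\<in>{n+2..l}. N + r i - 2 * k < 0)"
  shows "h_pts n l p r k = 0"
proof -
  have "Sdeg n k \<subseteq> power_ideal n l p r k"
    using assms(2)
  proof
    assume "N < k"
    then have "Sdeg n k \<subseteq> outside_box n \<rho> k"
      unfolding N_def by (rule Sdeg_subset_outside_box)
    then show ?thesis using outside_box_subset_power_ideal by blast
  next
    assume "\<exists>i\<in>{n+2..l}. N + r i - 2 * k < 0"
    then obtain i where i: "i \<in> {n+2..l}" "0 = nat (N + r i - 2 * k)" by auto
    show ?thesis
    proof
      fix u :: "(nat \<Rightarrow> 'a) \<Rightarrow> 'a" assume "u \<in> Sdeg n k"
      then show "u \<in> power_ideal n l p r k"
        using funpow_lower_sum_in_power_ideal[OF i, of u] by simp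
    qed
  qed
  then have "power_ideal n l p r k = Sdeg n k"
    using power_ideal_subset_Sdeg[OF r, of n p k] by blast
  then show ?thesis unfolding h_pts_eq[OF k r] by simp
qed

text \<open>The reflection of the box turns multiplication by the form with inverted coefficients
  into the lowering operator.\<close>
lemma h_pts_special_le:
  fixes k' :: int and r' :: "nat \<Rightarrow> int" and p' :: "nat \<Rightarrow> nat \<Rightarrow> 'a"
  defines "k' \<equiv> N - k"
    and "r' \<equiv> \<lambda>i. if i \<le> n + 1 then r i else N + r i - 2 * k"
    and "p' \<equiv> \<lambda>i. if i \<le> n + 1 then p i else (\<lambda>j. inverse (p i j))"
  assumes k: "k \<ge> 0" "k' \<ge> 0" and r': "\<forall>i\<in>{1..l}. r' i \<ge> 0"
  shows "h_pts n l p r k \<le> h_pts n l p' r' k'"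
  unfolding h_pts_eq[OF k(1) r] h_pts_eq[OF k(2) r']
proof (rule fsp.codim_le_codim[OF linear_reflect_op[of n \<rho>]])
  show "power_ideal n l p' r' k' \<subseteq> Sdeg n k'" "power_ideal n l p r k \<subseteq> Sdeg n k"
    by (intro power_ideal_subset_Sdeg r r')+
  show "Sdeg n k' \<subseteq> fspan {monom_fun n a | a. int (\<Sum>j\<le>n. a j) = k'}"
    "Sdeg n k \<subseteq> fspan {monom_fun n a | a. int (\<Sum>j\<le>n. a j) = k}"
    unfolding Sdeg_def by (rule order_refl)+
  show "finite {monom_fun n a | a. int (\<Sum>j\<le>n. a j) = k'}"
    "finite {monom_fun n a | a. int (\<Sum>j\<le>n. a j) = k}"
    by (rule finite_monomials)+
  have "reflect_op n \<rho> v \<in> power_ideal n l p r k" if v: "v \<in> power_ideal n l p' r' k'" for v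
  proof (rule linear_image_span[OF linear_reflect_op subspace_power_ideal _
      v[unfolded power_ideal_def]])
    fix b :: "(nat \<Rightarrow> 'a) \<Rightarrow> 'a"
    assume "b \<in> {lin_form n (p' i) ^ nat (r' i) * u | i u. i \<in> {1..l} \<and> u \<in> Sdeg n (k' - r' i)}"
    then obtain i u where i: "i \<in> {1..l}" and u: "u \<in> Sdeg n (k' - r' i)"
      and b: "b = lin_form n (p' i) ^ nat (r' i) * u" by blast
    show "reflect_op n \<rho> b \<in> power_ideal n l p r k"
    proof (cases "i \<le> n + 1")
      \<comment> \<open>The first \<open>n + 1\<close> generators involve
        \<open>var j ^ \<rho> j\<close>, which pushes every monomial out of the box.\<close>
      case True
      then obtain j where j: "i = Suc j" "j \<le> n" using i by (cases i) auto
      have "p' i = p (Suc j)" "nat (r' i) = \<rho> j"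
        using True j by (simp_all add: p'_def r'_def \<rho>_def)
      then have "reflect_op n \<rho> b = 0"
        unfolding b using reflect_op_var_power_mult[OF j(2) u, of \<rho>]
        by (simp only: special_config_lin_form[OF special j(2)])
      then show ?thesis by (simp only: fs.subspace_0 subspace_power_ideal)
    next
      case False
      define m where "m = nat (N + r i - 2 * k)"
      have i': "i \<in> {n+2..l}" using False i by auto
      have "r' i \<ge> 0" using r' i by blast
      then have m: "nat (r' i) = m" "p' i = (\<lambda>j. inverse (p i j))" "r' i = int m"
        using False by (simp_all add: p'_def r'_def m_def)
      have "reflect_op n \<rho> u \<in> Sdeg n (k + int m)"
        using reflect_op_in_Sdeg[OF u, of \<rho>] m(3) by (simp add: k'_def flip: N_def)
      then show ?thesis
        unfolding b reflect_op_lin_form_power_mult[OF u] m(1,2)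
        by (rule funpow_lower_sum_in_power_ideal[OF i' m_def])
    qed
  qed
  then show "reflect_op n \<rho> ` power_ideal n l p' r' k' \<subseteq> fspan (power_ideal n l p r k)"
    using fs.span_superset by blast
  \<comment> \<open>Surjectivity modulo the ideal: a monomial inside the box is, up to a nonzero
    product of factorials, the reflection of its complementary monomial of degree
    \<open>k'\<close>.\<close>
  have "monom_fun n a \<in> fspan (reflect_op n \<rho> ` Sdeg n k' \<union> power_ideal n l p r k)"
    if a: "int (\<Sum>j\<le>n. a j) = k" for a
  proof (cases "\<forall>j\<le>n. a j < \<rho> j")
    case False
    then have "monom_fun n a \<in> power_ideal n l p r k"
      using monom_fun_in_outside_box[OF a] outside_box_subset_power_ideal
      by (meson not_less subsetD)
    then show ?thesis by (intro fs.span_base) blast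
  next
    case True
    let ?b = "\<lambda>j. \<rho> j - 1 - a j"
    define c :: 'a where "c = (\<Prod>j\<le>n. fact (?b j) / fact (\<rho> j - 1 - ?b j))"
    have "c \<noteq> 0" unfolding c_def by simp
    have b': "?b j < \<rho> j \<and> \<rho> j - 1 - ?b j = a j" if "j \<le> n" for j
    proof -
      have "a j < \<rho> j" using True that by blast
      then show ?thesis by linarith
    qed
    then have b: "\<forall>j\<le>n. ?b j < \<rho> j" by blast
    have mb: "monom_fun n (\<lambda>j. \<rho> j - 1 - ?b j) = (monom_fun n a :: (nat \<Rightarrow> 'a) \<Rightarrow> 'a)"
      by (intro monom_fun_cong) (simp only: b')
    have refl: "reflect_op n \<rho> (monom_fun n ?b) = fscale c (monom_fun n a)"
      unfolding reflect_op_monom_fun if_P[OF b] mb c_def ..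
    have eq: "monom_fun n a = fscale (inverse c) (reflect_op n \<rho> (monom_fun n ?b))"
      unfolding refl fs.scale_scale field_class.field_inverse[OF \<open>c \<noteq> 0\<close>] fs.scale_one ..
    have "int (\<Sum>j\<le>n. ?b j) = k'"
    proof -
      have "int (\<Sum>j\<le>n. ?b j) = (\<Sum>j\<le>n. int (\<rho> j) - 1 - int (a j))"
        unfolding of_nat_sum using True by (intro sum.cong) (auto simp: of_nat_diff Suc_le_eq)
      also have "\<dots> = N - k"
        unfolding a[symmetric] N_def by (simp only: sum_subtractf of_nat_sum)
      finally show ?thesis by (simp add: k'_def)
    qed
    then show ?thesis
      unfolding eq by (intro fs.span_scale fs.span_base UnI1 imageI monom_fun_in_Sdeg)
  qed
  then show "Sdeg n k \<subseteq> fspan (reflect_op n \<rho> ` Sdeg n k' \<union> power_ideal n l p r k)"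
    unfolding Sdeg_def[of n k] by (intro fs.span_minimal fs.subspace_span) blast
qed

end

subsection \<open>Reduction to special position\<close>

text \<open>Semicontinuity along a line of configurations: a basis of the ideal in degree
  \<open>k\<close> deforms polynomially in \<open>t\<close> and stays independent for all but
  finitely many \<open>t\<close>, so the ideal does not shrink there.\<close>

lemma finite_h_pts_perturb_greater:
  fixes p d :: "nat \<Rightarrow> nat \<Rightarrow> 'a::field_char_0"
  assumes k: "k \<ge> 0" and r: "\<forall>i\<in>{1..l}. r i \<ge> 0"
  shows "finite {t. \<not> h_pts n l (\<lambda>i j. p i j + t * d i j) r k \<le> h_pts n l p r k}"
proof -
  let ?P = "\<lambda>t i j. p i j + t * d i j"
  let ?G = "{lin_form n (p i) ^ nat (r i) * u | i u. i \<in> {1..l} \<and> u \<in> Sdeg n (k - r i)}"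
  let ?M = "{monom_fun n a | a. int (\<Sum>j\<le>n. a j) = k} :: ((nat \<Rightarrow> 'a) \<Rightarrow> 'a) set"
  \<comment> \<open>The basis is chosen among the generators, since each of these has an evident
    deformation.\<close>
  obtain B where B: "B \<subseteq> ?G" "fs.independent B" "card B = fdim ?G"
    by (rule fs.basis_exists)
  have "B \<subseteq> power_ideal n l p r k"
    using B(1) fs.span_superset unfolding power_ideal_def by blast
  then have "B \<subseteq> fspan ?M"
    using power_ideal_subset_Sdeg[OF r] unfolding Sdeg_def by blast
  then have finB: "finite B"
    using fs.independent_span_bound[OF finite_monomials B(2)] by blast
  have "\<forall>b\<in>B. \<exists>iu. fst iu \<in> {1..l} \<and> snd iu \<in> Sdeg n (k - r (fst iu)) \<and>
      b = lin_form n (p (fst iu)) ^ nat (r (fst iu)) * snd iu"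
  proof
    fix b assume "b \<in> B"
    then obtain i u where "b = lin_form n (p i) ^ nat (r i) * u" "i \<in> {1..l}" "u \<in> Sdeg n (k - r i)"
      using B(1) by blast
    then show "\<exists>iu. fst iu \<in> {1..l} \<and> snd iu \<in> Sdeg n (k - r (fst iu)) \<and>
        b = lin_form n (p (fst iu)) ^ nat (r (fst iu)) * snd iu"
      by (intro exI[of _ "(i, u)"]) (simp only: fst_conv snd_conv)
  qed
  from bchoice[OF this] obtain c where c0: "\<forall>b\<in>B. fst (c b) \<in> {1..l} \<and>
      snd (c b) \<in> Sdeg n (k - r (fst (c b))) \<and>
      b = lin_form n (p (fst (c b))) ^ nat (r (fst (c b))) * snd (c b)" ..
  then have c: "fst (c b) \<in> {1..l}" "snd (c b) \<in> Sdeg n (k - r (fst (c b)))"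
    "b = lin_form n (p (fst (c b))) ^ nat (r (fst (c b))) * snd (c b)" if "b \<in> B" for b
    using that by blast+
  define f where "f t b = lin_form n (?P t (fst (c b))) ^ nat (r (fst (c b))) * snd (c b)" for t b
  \<comment> \<open>For fixed \<open>x\<close>, the value \<open>f t b x\<close> as a polynomial in
    \<open>t\<close>.\<close>
  define g where "g b x = (\<Sum>j\<le>n. smult (x j) [:p (fst (c b)) j, d (fst (c b)) j:])
      ^ nat (r (fst (c b))) * [:snd (c b) x:]" for b x
  have g: "poly (g b x) t = f t b x" for b x t
    by (simp add: f_def g_def lin_form_def poly_sum algebra_simps)
  have "f 0 b = b" if "b \<in> B" for b
    unfolding f_def mult_zero_left add_0_right by (rule c(3)[OF that, symmetric])
  then have "(\<Sum>b\<in>B. e b * poly (g b x) 0) = (\<Sum>b\<in>B. e b * b x)" for e x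
    unfolding g by (intro sum.cong refl) (simp only:)
  then have "indep_family B (\<lambda>b x. poly (g b x) 0)"
    using independent_imp_indep_family[OF finB B(2)] unfolding indep_family_def by (simp only:)
  then have fin: "finite {t. \<not> indep_family B (\<lambda>b x. poly (g b x) t)}"
    by (rule finite_not_indep_family_poly[OF finB])
  have le: "h_pts n l (?P t) r k \<le> h_pts n l p r k"
    if "indep_family B (\<lambda>b x. poly (g b x) t)" for t
  proof -
    have ind: "indep_family B (f t)" using that by (simp only: g)
    have "fdim (power_ideal n l p r k) = card B"
      unfolding B(3) power_ideal_def fs.dim_span ..
    also have "\<dots> = card (f t ` B)"
      using card_image[OF indep_family_imp_inj_on[OF finB ind]] by simp
    also have "\<dots> \<le> fdim (power_ideal n l (?P t) r k)"
    proof (rule fs.independent_card_le_dim_span[OF _ _ _ finite_monomials])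
      show "fs.independent (f t ` B)"
        by (rule indep_family_imp_independent[OF finB ind])
      show "f t ` B \<subseteq> power_ideal n l (?P t) r k"
        unfolding f_def using c(1,2) by (auto intro!: power_idealI[where p = "?P t"])
      show "power_ideal n l (?P t) r k \<subseteq> fspan ?M"
        using power_ideal_subset_Sdeg[OF r, of n "?P t" k] unfolding Sdeg_def .
    qed
    finally show ?thesis
      unfolding h_pts_eq[OF k r] by (rule diff_le_mono2)
  qed
  have "{t. \<not> h_pts n l (?P t) r k \<le> h_pts n l p r k}
      \<subseteq> {t. \<not> indep_family B (\<lambda>b x. poly (g b x) t)}"
    using le by blast
  then show ?thesis using fin by (rule finite_subset)
qed

text \<open>Independence of the first \<open>n + 1\<close> forms and semicontinuity each fail for
  only finitely many \<open>t\<close> on a suitable line, and the field is infinite.\<close>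

lemma exists_independent_config:
  fixes p :: "nat \<Rightarrow> nat \<Rightarrow> 'a::field_char_0"
  assumes k: "k \<ge> 0" and r: "\<forall>i\<in>{1..l}. r i \<ge> 0"
  shows "\<exists>q. indep_family {..n} (\<lambda>m. lin_form n (q (Suc m) :: nat \<Rightarrow> 'a))
    \<and> h_pts n l q r k \<le> h_pts n l p r k"
proof -
  \<comment> \<open>The line starts at \<open>p\<close>; at \<open>t = 1\<close> its first
    \<open>n + 1\<close> points are the unit vectors in the coordinates up to
    \<open>n\<close>.\<close>
  define d where "d i j = (if Suc j = i then 1 else 0) - p i j" for i j
  define g where "g m x = (\<Sum>j\<le>n. smult (x j) [:p (Suc m) j, d (Suc m) j:])" for m x
  have g: "poly (g m x) t = lin_form n (\<lambda>j. p (Suc m) j + t * d (Suc m) j) x" for m x t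
    by (simp add: g_def lin_form_def poly_sum algebra_simps)
  have "poly (g m x) 1 = x m" if "m \<le> n" for m x
  proof -
    have *: "(\<lambda>j. p (Suc m) j + 1 * d (Suc m) j) = (\<lambda>j. if j = m then 1 else 0)"
      by (auto simp: d_def)
    show ?thesis unfolding g * lin_form_unit[OF that] var_def ..
  qed
  then have g1: "(\<Sum>m\<le>n. c m * poly (g m x) 1) = (\<Sum>m\<le>n. c m * x m)" for c x
    by (intro sum.cong) auto
  have "indep_family {..n} (\<lambda>m x. poly (g m x) 1)"
    unfolding indep_family_def g1
  proof (intro allI impI)
    fix c :: "nat \<Rightarrow> 'a" assume 0: "\<forall>x. (\<Sum>m\<le>n. c m * x m) = 0"
    have "c m = 0" if "m \<le> n" for m
    proof -
      have "(\<Sum>i\<le>n. c i * (if i = m then 1 else 0)) = (\<Sum>i\<le>n. if i = m then c m else 0)"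
        by (rule sum.cong) auto
      then show ?thesis using 0[rule_format, of "\<lambda>i. if i = m then 1 else 0"] that by simp
    qed
    then show "\<forall>m\<in>{..n}. c m = 0" by blast
  qed
  then have "finite {t. \<not> indep_family {..n} (\<lambda>m x. poly (g m x) t)}"
    by (intro finite_not_indep_family_poly) simp_all
  with finite_h_pts_perturb_greater[OF k r, of n p d]
  have "finite ({t. \<not> h_pts n l (\<lambda>i j. p i j + t * d i j) r k \<le> h_pts n l p r k}
      \<union> {t. \<not> indep_family {..n} (\<lambda>m x. poly (g m x) t)})" by blast
  from ex_new_if_finite[OF infinite_UNIV_char_0 this] obtain t
    where "h_pts n l (\<lambda>i j. p i j + t * d i j) r k \<le> h_pts n l p r k"
      "indep_family {..n} (\<lambda>m x. poly (g m x) t)" by blast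
  then show ?thesis
    unfolding g by (intro exI[of _ "\<lambda>i j. p i j + t * d i j"] conjI)
qed

lemma prod_fun_apply: "(\<Prod>i\<in>A. f i) x = (\<Prod>i\<in>A. f i x :: 'a::comm_monoid_mult)"
  by (induction A rule: infinite_finite_induct) simp_all

lemma prod_lin_form_in_Sdeg:
  assumes "finite A"
  shows "(\<Prod>j\<in>A. lin_form n (c j) ^ a j) \<in> Sdeg n (int (\<Sum>j\<in>A. a j))"
  using assms
proof (induction A rule: finite_induct)
  case empty
  show ?case using one_in_Sdeg by (simp only: prod.empty sum.empty of_nat_0)
next
  case (insert j A)
  have "lin_form n (c j) ^ a j * (\<Prod>j\<in>A. lin_form n (c j) ^ a j)
      \<in> Sdeg n (int (a j) * 1 + int (\<Sum>j\<in>A. a j))"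
    by (intro Sdeg_mult Sdeg_power lin_form_in_Sdeg insert.IH)
  then show ?case
    by (simp only: prod.insert[OF insert.hyps] sum.insert[OF insert.hyps] of_nat_add mult_1_right)
qed

text \<open>Substitution by the inverse of the matrix of the first \<open>n + 1\<close> points.\<close>
lemma exists_unit_config:
  fixes p :: "nat \<Rightarrow> nat \<Rightarrow> 'a::field_char_0"
  assumes k: "k \<ge> 0" and r: "\<forall>i\<in>{1..l}. r i \<ge> 0"
    and ind: "indep_family {..n} (\<lambda>m. lin_form n (p (Suc m)))"
  shows "\<exists>q. (\<forall>j\<le>n. q (Suc j) = (\<lambda>i. if i = j then 1 else 0 :: 'a))
    \<and> h_pts n l q r k \<le> h_pts n l p r k"
proof -
  let ?L = "\<lambda>m. lin_form n (p (Suc m))"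
  let ?B = "?L ` {..n}"
  let ?X = "var ` {..n} :: ((nat \<Rightarrow> 'a) \<Rightarrow> 'a) set"
  have indB: "fs.independent ?B" by (rule indep_family_imp_independent[OF _ ind]) simp
  have injB: "inj_on ?L {..n}" by (rule indep_family_imp_inj_on[OF _ ind]) simp
  have BX: "?B \<subseteq> fspan ?X"
    unfolding lin_form_eq
    by (intro image_subsetI fs.span_sum fs.span_scale fs.span_base imageI)
  \<comment> \<open>Otherwise \<open>n + 2\<close> independent functions would lie in the span of
    \<open>n + 1\<close> variables.\<close>
  have span: "var j \<in> fspan ?B" if "j \<le> n" for j
  proof (rule ccontr)
    assume j: "var j \<notin> fspan ?B"
    have sub: "insert (var j) ?B \<subseteq> fspan ?X"
      using BX fs.span_base[of "var j" ?X] that by blast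
    have ind': "fs.independent (insert (var j) ?B)"
      using j indB by (rule fs.independent_insertI)
    have "card (insert (var j) ?B) \<le> card ?X"
      using fs.independent_span_bound[OF _ ind' sub] by simp
    moreover have "card ?X \<le> card {..n}" by (rule card_image_le) simp
    moreover have "var j \<notin> ?B"
    proof
      assume "var j \<in> ?B"
      then have "var j \<in> fspan ?B" by (rule fs.span_base)
      with j show False ..
    qed
    then have "card (insert (var j) ?B) = Suc (Suc n)"
      using card_image[OF injB] by (subst card_insert_disjoint) simp_all
    ultimately show False by simp
  qed
  have "\<exists>u. var j = (\<Sum>m\<le>n. fscale (u m) (?L m))" if j: "j \<le> n" for j
  proof -
    have "fspan ?B = range (\<lambda>w. \<Sum>v\<in>?B. fscale (w v) v)"
      by (rule fs.span_finite) simp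
    then obtain w where "var j = (\<Sum>v\<in>?B. fscale (w v) v)"
      using span[OF j] by blast
    also have "\<dots> = (\<Sum>m\<le>n. fscale (w (?L m)) (?L m))"
      by (simp add: sum.reindex[OF injB])
    finally show ?thesis by (intro exI[of _ "\<lambda>m. w (?L m)"])
  qed
  then have "\<forall>j\<in>{..n}. \<exists>u. var j = (\<Sum>m\<le>n. fscale (u m) (?L m))" by blast
  from bchoice[OF this] obtain U
    where U': "\<forall>j\<in>{..n}. var j = (\<Sum>m\<le>n. fscale (U j m) (?L m))" ..
  have U: "x j = (\<Sum>m\<le>n. U j m * ?L m x)" if j: "j \<le> n" for j x
  proof -
    have "var j = (\<Sum>m\<le>n. fscale (U j m) (?L m))" using U' j by blast
    from fun_cong[OF this, of x] show ?thesis by (simp only: var_def sum_fun_apply fscale_apply)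
  qed
  \<comment> \<open>The coefficients of the form of \<open>p i\<close> in the basis of the first
    \<open>n + 1\<close> forms. The value 0 beyond \<open>n\<close> makes \<open>q (Suc m)\<close>
    equal to a unit vector as a function, as \<open>special_config\<close> demands.\<close>
  define q where "q i m = (if m \<le> n then \<Sum>j\<le>n. p i j * U j m else 0)" for i m
  have q: "q (Suc m) = (\<lambda>i. if i = m then 1 else 0)" if m: "m \<le> n" for m
  proof -
    have "(\<Sum>i\<le>n. (q (Suc m) i - (if i = m then 1 else 0)) * ?L i x) = 0" for x
    proof -
      have "(\<Sum>i\<le>n. q (Suc m) i * ?L i x) = (\<Sum>i\<le>n. \<Sum>j\<le>n. p (Suc m) j * (U j i * ?L i x))"
        by (intro sum.cong) (auto simp: q_def sum_distrib_right mult.assoc)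
      also have "\<dots> = (\<Sum>j\<le>n. p (Suc m) j * (\<Sum>i\<le>n. U j i * ?L i x))"
        by (subst sum.swap) (simp only: sum_distrib_left)
      also have "\<dots> = (\<Sum>j\<le>n. p (Suc m) j * x j)"
        by (intro sum.cong refl) (simp only: atMost_iff U[symmetric])
      also have "\<dots> = ?L m x" by (simp add: lin_form_def)
      also have "\<dots> = (\<Sum>i\<le>n. if i = m then ?L m x else 0)" using m by simp
      also have "\<dots> = (\<Sum>i\<le>n. (if i = m then 1 else 0) * ?L i x)"
        by (intro sum.cong) auto
      finally show ?thesis by (simp only: left_diff_distrib sum_subtractf diff_self)
    qed
    then have "q (Suc m) i - (if i = m then 1 else 0) = 0" if "i \<le> n" for i
      using indep_familyD[OF ind, of "\<lambda>i. q (Suc m) i - (if i = m then 1 else 0)"] that by simp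
    then show ?thesis using m by (force simp: q_def)
  qed
  \<comment> \<open>Substituting \<open>lin_form n (U j)\<close> for the \<open>j\<close>-th
    coordinate sends the form of \<open>p i\<close> to that of \<open>q i\<close>, in particular
    \<open>?L m\<close> to \<open>var m\<close>.\<close>
  define \<Phi> :: "((nat \<Rightarrow> 'a) \<Rightarrow> 'a) \<Rightarrow> (nat \<Rightarrow> 'a) \<Rightarrow> 'a"
    where "\<Phi> f = (\<lambda>x. f (\<lambda>j. lin_form n (U j) x))" for f
  have \<Phi>_lin: "flinear \<Phi>" by (intro flinearI) (simp_all add: \<Phi>_def fun_eq_iff)
  have \<Phi>_mult: "\<Phi> (u * v) = \<Phi> u * \<Phi> v" and \<Phi>_power: "\<Phi> (u ^ e) = \<Phi> u ^ e" for u v e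
    by (simp_all add: \<Phi>_def fun_eq_iff)
  have \<Phi>_form: "\<Phi> (lin_form n (p i)) = lin_form n (q i)" for i
  proof
    fix x
    have "\<Phi> (lin_form n (p i)) x = (\<Sum>j\<le>n. \<Sum>m\<le>n. p i j * U j m * x m)"
      by (simp add: \<Phi>_def lin_form_def sum_distrib_left mult.assoc)
    also have "\<dots> = (\<Sum>m\<le>n. \<Sum>j\<le>n. p i j * U j m * x m)" by (rule sum.swap)
    also have "\<dots> = lin_form n (q i) x"
      unfolding lin_form_def q_def by (intro sum.cong) (auto simp: sum_distrib_right)
    finally show "\<Phi> (lin_form n (p i)) x = lin_form n (q i) x" .
  qed
  have \<Phi>_Sdeg: "\<Phi> u \<in> Sdeg n e" if u: "u \<in> Sdeg n e" for u e
  proof (rule linear_image_Sdeg[OF \<Phi>_lin subspace_Sdeg u])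
    fix a :: "nat \<Rightarrow> nat" assume a: "int (\<Sum>j\<le>n. a j) = e"
    have "\<Phi> (monom_fun n a) = (\<Prod>j\<le>n. lin_form n (U j) ^ a j)"
      by (simp add: \<Phi>_def monom_fun_def fun_eq_iff prod_fun_apply)
    also have "\<dots> \<in> Sdeg n e"
      unfolding a[symmetric] by (rule prod_lin_form_in_Sdeg) simp
    finally show "\<Phi> (monom_fun n a) \<in> Sdeg n e" .
  qed
  have "h_pts n l q r k \<le> h_pts n l p r k"
    unfolding h_pts_eq[OF k r]
  proof (rule fsp.codim_le_codim[OF \<Phi>_lin])
    show "power_ideal n l p r k \<subseteq> Sdeg n k" "power_ideal n l q r k \<subseteq> Sdeg n k"
      by (intro power_ideal_subset_Sdeg r)+
    show "(Sdeg n k :: ((nat \<Rightarrow> 'a) \<Rightarrow> 'a) set) \<subseteq> fspan {monom_fun n a | a. int (\<Sum>j\<le>n. a j) = k}"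
      "(Sdeg n k :: ((nat \<Rightarrow> 'a) \<Rightarrow> 'a) set) \<subseteq> fspan {monom_fun n a | a. int (\<Sum>j\<le>n. a j) = k}"
      unfolding Sdeg_def by (rule order_refl)+
    show "finite ({monom_fun n a | a. int (\<Sum>j\<le>n. a j) = k} :: ((nat \<Rightarrow> 'a) \<Rightarrow> 'a) set)"
      "finite ({monom_fun n a | a. int (\<Sum>j\<le>n. a j) = k} :: ((nat \<Rightarrow> 'a) \<Rightarrow> 'a) set)"
      by (rule finite_monomials)+
    have "\<Phi> v \<in> power_ideal n l q r k" if v: "v \<in> power_ideal n l p r k" for v
    proof (rule linear_image_span[OF \<Phi>_lin subspace_power_ideal _ v[unfolded power_ideal_def]])
      fix b :: "(nat \<Rightarrow> 'a) \<Rightarrow> 'a"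
      assume "b \<in> {lin_form n (p i) ^ nat (r i) * u | i u. i \<in> {1..l} \<and> u \<in> Sdeg n (k - r i)}"
      then show "\<Phi> b \<in> power_ideal n l q r k"
        by (auto simp only: \<Phi>_mult \<Phi>_power \<Phi>_form intro!: power_idealI[where p = q] \<Phi>_Sdeg)
    qed
    then show "\<Phi> ` power_ideal n l p r k \<subseteq> fspan (power_ideal n l q r k)"
      using fs.span_superset by blast
    \<comment> \<open>Surjectivity: the same monomial formed in the \<open>?L j\<close> is a
      preimage.\<close>
    have "monom_fun n a \<in> \<Phi> ` Sdeg n k" if a: "int (\<Sum>j\<le>n. a j) = k" for a
    proof
      have "\<Phi> (\<Prod>j\<le>n. ?L j ^ a j) = (\<Prod>j\<le>n. \<Phi> (?L j) ^ a j)"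
        by (simp add: \<Phi>_def fun_eq_iff prod_fun_apply)
      also have "\<dots> = (\<Prod>j\<le>n. var j ^ a j)"
        by (intro prod.cong refl) (simp only: \<Phi>_form q atMost_iff lin_form_unit)
      also have "\<dots> = monom_fun n a"
        by (simp add: monom_fun_def var_def fun_eq_iff prod_fun_apply)
      finally show "monom_fun n a = \<Phi> (\<Prod>j\<le>n. ?L j ^ a j)" ..
      show "(\<Prod>j\<le>n. ?L j ^ a j) \<in> Sdeg n k"
        unfolding a[symmetric] by (rule prod_lin_form_in_Sdeg) simp
    qed
    then show "Sdeg n k \<subseteq> fspan (\<Phi> ` Sdeg n k \<union> power_ideal n l q r k)"
      unfolding Sdeg_def[of n k]
      by (intro fs.span_minimal fs.subspace_span) (blast intro: fs.span_base)
  qed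
  then show ?thesis using q by blast
qed

lemma exists_special_config:
  fixes p :: "nat \<Rightarrow> nat \<Rightarrow> 'a::field_char_0"
  assumes k: "k \<ge> 0" and r: "\<forall>i\<in>{1..l}. r i \<ge> 0" and l: "n + 1 < l"
  shows "\<exists>q. special_config n l (q :: nat \<Rightarrow> nat \<Rightarrow> 'a) \<and> h_pts n l q r k \<le> h_pts n l p r k"
proof -
  obtain p1 where p1: "indep_family {..n} (\<lambda>m. lin_form n (p1 (Suc m) :: nat \<Rightarrow> 'a))"
    "h_pts n l p1 r k \<le> h_pts n l p r k"
    using exists_independent_config[OF k r] by blast
  obtain p2 where p2: "\<forall>j\<le>n. p2 (Suc j) = (\<lambda>i. if i = j then 1 else 0 :: 'a)"
    "h_pts n l p2 r k \<le> h_pts n l p1 r k"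
    using exists_unit_config[OF k r p1(1)] by blast
  \<comment> \<open>Only the points beyond the unit vectors move, all in direction
    \<open>(1, ..., 1)\<close>; each of their coordinates vanishes for just one
    \<open>t\<close>.\<close>
  define d :: "nat \<Rightarrow> nat \<Rightarrow> 'a" where "d i j = (if i \<le> n + 1 then 0 else 1)" for i j
  have "finite ({t. \<not> h_pts n l (\<lambda>i j. p2 i j + t * d i j) r k \<le> h_pts n l p2 r k}
      \<union> (\<lambda>(i, j). - p2 i j) ` ({n+2..l} \<times> {..n}))"
    using finite_h_pts_perturb_greater[OF k r, of n p2 d] by blast
  from ex_new_if_finite[OF infinite_UNIV_char_0 this] obtain t
    where t: "h_pts n l (\<lambda>i j. p2 i j + t * d i j) r k \<le> h_pts n l p2 r k"
      and nz: "t \<notin> (\<lambda>(i, j). - p2 i j) ` ({n+2..l} \<times> {..n})" by blast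
  have "special_config n l (\<lambda>i j. p2 i j + t * d i j)"
    unfolding special_config_def
  proof (intro conjI ballI allI impI l)
    fix j assume "j \<le> n"
    then show "(\<lambda>i. p2 (Suc j) i + t * d (Suc j) i) = (\<lambda>i. if i = j then 1 else 0)"
      using p2(1) by (simp add: d_def fun_eq_iff)
  next
    fix i j assume ij: "i \<in> {n+2..l}" "j \<le> n"
    then have "t \<noteq> - p2 i j" using nz by force
    then show "p2 i j + t * d i j \<noteq> 0"
      using ij by (simp add: d_def add_eq_0_iff)
  qed
  then show ?thesis using t p1(2) p2(2) by (meson order_trans)
qed

lemma special_config_nonzero_pt:
  assumes "special_config n l p" "i \<in> {1..l}"
  shows "nonzero_pt n (p i)"
proof (cases "i \<le> n + 1")
  case True
  then obtain j where j: "i = Suc j" "j \<le> n" using assms(2) by (cases i) auto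
  then have "p i j = 1" using assms(1) by (simp add: special_config_def)
  then show ?thesis using j(2) unfolding nonzero_pt_def by (metis zero_neq_one)
next
  case False
  then have "p i 0 \<noteq> 0" using assms by (simp add: special_config_def)
  then show ?thesis unfolding nonzero_pt_def by blast
qed

subsection \<open>The symmetry of the generic Hilbert function\<close>

text \<open>All values are bounded by the dimension of \<open>Sdeg n k\<close>; this gives
  \<open>Min\<close> in \<open>h_gen\<close> its intended meaning.\<close>

lemma finite_h_pts_values:
  fixes P :: "(nat \<Rightarrow> nat \<Rightarrow> 'a::field) \<Rightarrow> bool"
  shows "finite {h_pts n l p r k | p. P p}"
  by (rule finite_subset[of _ "{..fdim (Sdeg n k :: ((nat \<Rightarrow> 'a) \<Rightarrow> 'a) set)}"])
    (auto simp: h_pts_def)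

lemma h_gen_le_h_pts:
  assumes "special_config n l p"
  shows "h_gen TYPE('a::field) n l r k \<le> h_pts n l (p :: nat \<Rightarrow> nat \<Rightarrow> 'a) r k"
  using special_config_nonzero_pt[OF assms] unfolding h_gen_def
  by (auto intro!: Min_le finite_h_pts_values)

text \<open>The minimum is attained by some configuration, and moving that one into special position
  does not increase the value.\<close>

lemma exists_special_config_h_gen:
  assumes "k \<ge> 0" "\<forall>i\<in>{1..l}. r i \<ge> 0" "n + 1 < l"
  shows "\<exists>q. special_config n l q
    \<and> h_pts n l (q :: nat \<Rightarrow> nat \<Rightarrow> 'a::field_char_0) r k \<le> h_gen TYPE('a) n l r k"
proof -
  let ?S = "{h_pts n l (p :: nat \<Rightarrow> nat \<Rightarrow> 'a) r k | p. \<forall>i\<in>{1..l}. nonzero_pt n (p i)}"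
  have "nonzero_pt n (\<lambda>_. 1 :: 'a)" by (auto simp: nonzero_pt_def)
  then have "h_pts n l (\<lambda>_ _. 1 :: 'a) r k \<in> ?S"
    by (intro CollectI exI[of _ "\<lambda>_ _. 1 :: 'a"] conjI ballI refl)
  then have "?S \<noteq> {}" by (rule ex_in_conv[THEN iffD1, OF exI])
  then have "Min ?S \<in> ?S" by (intro Min_in finite_h_pts_values)
  moreover have "h_gen TYPE('a) n l r k = Min ?S"
    using assms by (auto simp: h_gen_def not_less[symmetric])
  ultimately obtain p :: "nat \<Rightarrow> nat \<Rightarrow> 'a" where "h_gen TYPE('a) n l r k = h_pts n l p r k"
    by auto
  then show ?thesis using exists_special_config[OF assms, of p] by simp
qed

text \<open>An optimal special configuration for the right-hand side is carried by the Cremona map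
  to one for the left-hand side with no larger value.\<close>

lemma h_gen_le_h_gen:
  fixes n l :: nat and r :: "nat \<Rightarrow> int" and k :: int
  assumes l: "n + 1 < l"
  defines "N \<equiv> (\<Sum>i=1..n+1. r i) - int n - 1"
  shows "h_gen TYPE('a::field_char_0) n l r k
    \<le> h_gen TYPE('a) n l (\<lambda>i. if i \<le> n + 1 then r i else N + r i - 2 * k) (N - k)"
    (is "_ \<le> h_gen _ _ _ ?r' _")
proof (cases "k < 0 \<or> (\<exists>i\<in>{1..l}. r i < 0)")
  case True
  then show ?thesis by (simp add: h_gen_def)
next
  case False
  then have k: "k \<ge> 0" and r: "\<forall>i\<in>{1..l}. r i \<ge> 0" by (auto simp: not_less)
  have N: "N = (\<Sum>j\<le>n. int (nat (r (Suc j))) - 1)"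
  proof -
    have "(\<Sum>j\<le>n. int (nat (r (Suc j))) - 1) = (\<Sum>j\<le>n. r (Suc j) - 1)"
      using r l by (intro sum.cong) auto
    also have "\<dots> = (\<Sum>j\<le>n. r (Suc j)) - int n - 1" by (simp add: sum_subtractf)
    also have "(\<Sum>j\<le>n. r (Suc j)) = (\<Sum>i=1..n+1. r i)"
      using sum.shift_bounds_cl_Suc_ivl[of r 0 n] by (simp add: atMost_atLeast0)
    finally show ?thesis by (simp add: N_def)
  qed
  show ?thesis
  proof (cases "N < k \<or> (\<exists>i\<in>{n+2..l}. N + r i - 2 * k < 0)")
    case True
    obtain q :: "nat \<Rightarrow> nat \<Rightarrow> 'a" where q: "special_config n l q"
      using exists_special_config_h_gen[OF k r l] by blast
    have "h_pts n l q r k = 0"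
      by (rule h_pts_special_eq_0[OF q r k True[unfolded N]])
    then show ?thesis using h_gen_le_h_pts[OF q, of r k] by simp
  next
    case False
    have r': "\<forall>i\<in>{1..l}. ?r' i \<ge> 0"
    proof
      fix i assume i: "i \<in> {1..l}"
      show "?r' i \<ge> 0"
      proof (cases "i \<le> n + 1")
        case True
        then show ?thesis using r i by simp
      next
        case i': False
        then have "i \<in> {n+2..l}" using i by simp
        then have "\<not> N + r i - 2 * k < 0" using False by blast
        then show ?thesis using i' by simp
      qed
    qed
    have k': "N - k \<ge> 0" using False by simp
    obtain q :: "nat \<Rightarrow> nat \<Rightarrow> 'a" where q: "special_config n l q"
      and hq: "h_pts n l q ?r' (N - k) \<le> h_gen TYPE('a) n l ?r' (N - k)"
      using exists_special_config_h_gen[OF k' r' l] by blast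
    \<comment> \<open>Coordinatewise inversion is an involution on special configurations, so
      \<open>q\<close> is in turn the Cremona image of \<open>p\<close>.\<close>
    define p where "p i = (if i \<le> n + 1 then q i else (\<lambda>j. inverse (q i j)))" for i
    have p: "special_config n l p"
      using q by (simp add: special_config_def p_def)
    have "(\<lambda>i. if i \<le> n + 1 then p i else (\<lambda>j. inverse (p i j))) = q"
      by (auto simp: p_def)
    then have "h_pts n l p r k \<le> h_pts n l q ?r' (N - k)"
      using h_pts_special_le[OF p r k, folded N, OF k' r'] by simp
    then show ?thesis using hq h_gen_le_h_pts[OF p, of r k] by simp
  qed
qed

theorem mainTheorem7:
  fixes n l :: nat and r :: "nat \<Rightarrow> int" and k :: int
  assumes "n \<ge> 1" and "l > n + 1" and "k \<ge> 0"
  defines "s \<equiv> (\<Sum>i=1..n+1. r i)"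
  defines "k' \<equiv> s - int n - 1 - k"
  defines "r' \<equiv> (\<lambda>i. if i \<le> n + 1 then r i else s - int n - 1 + r i - 2 * k)"
  shows "h_gen TYPE('a::{alg_closed_field, field_char_0}) n l r k
       = h_gen TYPE('a) n l r' k'"
proof (rule antisym)
  show "h_gen TYPE('a) n l r k \<le> h_gen TYPE('a) n l r' k'"
    using h_gen_le_h_gen[OF assms(2), of r k, where 'a = 'a]
    unfolding r'_def k'_def s_def by simp
  have s: "(\<Sum>i=1..n+1. r' i) = s"
    unfolding s_def by (rule sum.cong) (simp_all add: r'_def)
  \<comment> \<open>The transformation is an involution: \<open>s\<close> is unchanged, and with
    \<open>N = s - n - 1\<close> one has
    \<open>N + (N + r i - 2 * k) - 2 * (N - k) = r i\<close>.\<close>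
  have "(\<lambda>i. if i \<le> n + 1 then r' i else s - int n - 1 + r' i - 2 * k') = r"
    by (auto simp: r'_def k'_def)
  moreover have "s - int n - 1 - k' = k" by (simp add: k'_def)
  ultimately show "h_gen TYPE('a) n l r' k' \<le> h_gen TYPE('a) n l r k"
    using h_gen_le_h_gen[OF assms(2), of r' k', where 'a = 'a] unfolding s by simp
qed

end
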